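(* Let $X\subset\mathbb{R}^D$ and $f:X\to X$ be as in the context (an injective, non-singular, piecewise $C^1$-diffeomorphism with singular set $\Delta$), and let $\varepsilon\in(0,1)$. Let $p\geq1$ be such that $z\in\Lambda_p\setminus\overline{\Lambda}_{p+1}$. Let $\tau>0$, $y=-\ln\tau$ and $u_n=\frac{y}{a_n}+b_n$ with $a_n=D$ and $b_n$ such that $$m(B(z,e^{-b_n}))=\left(n\,\varepsilon\sum_{k=0}^p(1-\varepsilon)^kJ_k(z)\right)^{-1}=\frac{1}{n\,h_\varepsilon(z)}\qquad\forall\,n\in\mathbb{N},\ n\ge1,$$ where $B(z,r)$ denotes a ball of center $z$ and radius $r$. Then, with $Y_0(x)=-\log d(x,z)$, $$\lim_{n\to\infty}n\,\mathbb{P}(Y_0>u_n)=\tau.$$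
   Context: The map. $X$ is a compact subset of $\mathbb{R}^D$ which is the closure of its interior, $X=\overline{\mathrm{int}(X)}$, equipped with a metric $d$ and with the normalized Lebesgue measure $m$; balls are taken in the metric $d$. $\{X_i\}_{i=1}^N$ is a collection of $N$ disjoint open subsets of $X$ such that $X=\bigcup_{i=1}^N\overline{X_i}$ and $m(\Delta)=0$, where $\Delta:=X\setminus\bigcup_{i=1}^N X_i$ is the singular set. The map $f:X\to X$ is non-singular, injective, and such that $f|_{X\setminus\Delta}$ is a $C^1$-diffeomorphism (onto its image). Notation. $\Lambda_0:=X$ and $\Lambda_{k+1}:=f(\Lambda_k\setminus\Delta)$ for $k\ge0$. $J_0:=1$ and, for $k\ge1$ and $x\in\Lambda_k$, $J_k(x):=\prod_{l=1}^k|\det f'(f^{-l}(x))|^{-1}$. Randomly applied stochastic perturbation. Let $\Omega_\varepsilon=\{0,1\}\times X$ and let $\theta_\varepsilon$ be the product of the Bernoulli measure with weights $(\varepsilon,1-\varepsilon)$ on $\{0,1\}$ (so $0$ has probability $\varepsilon$) and the uniform measure on $X$. For $\omega=(\eta,\xi)\in\Omega_\varepsilon$ put $f_\omega(x)=\eta f(x)+(1-\eta)\xi$. Let $\mu_\varepsilon$ be the absolutely continuous stationary probability measure, i.e. $\mu_\varepsilon(A)=\int_X\int_{\Omega_\varepsilon}\mathbf 1_A(f_\omega(x))\,d\theta_\varepsilon(\omega)\,d\mu_\varepsilon(x)$ for all measurable $A\subset X$; its density with respect to $m$ is $h_\varepsilon=\varepsilon\sum_{k=0}^\infty(1-\varepsilon)^kJ_k\mathbf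 1_{\Lambda_k}$. Put $\mathbb{P}=\mu_\varepsilon\times\theta_\varepsilon^{\mathbb{N}}$ on $X\times\Omega_\varepsilon^{\mathbb{N}}$; $Y_0$ depends only on the initial point $x\in X$, so $\mathbb{P}(Y_0>u)=\mu_\varepsilon(\{x: -\log d(x,z)>u\})$.
   Formalization: The metric d is assumed to induce the usual topology of X and to satisfy d(x,z)/ν(x-z)→1 as x→z for some norm ν (false for arbitrary d: for d=|x-y|^{1/2} the limit is τ²); the X_i are taken open in R^D. *)

theory Defs
  imports "HOL-Probability.Probability"
begin

section \<open>The map\<close>

definition C1_on :: "(real^'n \<Rightarrow> real^'n) \<Rightarrow> (real^'n) set \<Rightarrow> bool" where
  "C1_on f U \<longleftrightarrow> (\<forall>x\<in>U. f differentiable (at x)) \<and>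
     continuous_on U (\<lambda>x. matrix (frechet_derivative f (at x)))"

definition C1_diffeo_on :: "(real^'n \<Rightarrow> real^'n) \<Rightarrow> (real^'n) set \<Rightarrow> bool" where
  "C1_diffeo_on f U \<longleftrightarrow> open U \<and> open (f ` U) \<and> C1_on f U \<and>
     (\<exists>g. C1_on g (f ` U) \<and> (\<forall>x\<in>U. g (f x) = x))"

definition nonsingular_map :: "'a measure \<Rightarrow> ('a \<Rightarrow> 'a) \<Rightarrow> bool" where
  "nonsingular_map M f \<longleftrightarrow> f \<in> measurable M M \<and>
     (\<forall>A\<in>null_sets M. f -` A \<inter> space M \<in> null_sets M)"

definition normalized_lebesgue :: "(real^'n) set \<Rightarrow> (real^'n) measure" where
  "normalized_lebesgue X = uniform_measure (lebesgue_on X) X"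

definition singular_set :: "(real^'n) set \<Rightarrow> nat \<Rightarrow> (nat \<Rightarrow> (real^'n) set) \<Rightarrow> (real^'n) set" where
  "singular_set X N Xs = X - (\<Union>i\<in>{1..N}. Xs i)"

primrec Lam :: "(real^'n) set \<Rightarrow> (real^'n \<Rightarrow> real^'n) \<Rightarrow> (real^'n) set \<Rightarrow> nat \<Rightarrow> (real^'n) set" where
  "Lam X f \<Delta> 0 = X"
| "Lam X f \<Delta> (Suc k) = f ` (Lam X f \<Delta> k - \<Delta>)"

text \<open>Only the values at points of \<open>Lam X f \<Delta> k\<close> are meaningful: there the \<open>l\<close>-fold preimages
  under the injective map \<open>f\<close>, \<open>1 \<le> l \<le> k\<close>, exist and lie in \<open>X - \<Delta>\<close>.\<close>

definition Jac :: "(real^'n) set \<Rightarrow> (real^'n \<Rightarrow> real^'n) \<Rightarrow> nat \<Rightarrow> real^'n \<Rightarrow> real" where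
  "Jac X f k x =
     (\<Prod>l=1..k. inverse \<bar>det (matrix (frechet_derivative f (at ((inv_into X f ^^ l) x))))\<bar>)"


section \<open>The metric\<close>

definition is_norm :: "('a::real_vector \<Rightarrow> real) \<Rightarrow> bool" where
  "is_norm \<nu> \<longleftrightarrow> (\<forall>x. 0 \<le> \<nu> x) \<and> (\<forall>x. \<nu> x = 0 \<longleftrightarrow> x = 0) \<and>
     (\<forall>c x. \<nu> (c *\<^sub>R x) = \<bar>c\<bar> * \<nu> x) \<and> (\<forall>x y. \<nu> (x + y) \<le> \<nu> x + \<nu> y)"

text \<open>To first order at \<open>z\<close> the metric is given by a norm. Some condition of this kind is needed
  to normalise the observable by \<open>a\<^sub>n = D\<close>: for the metric \<open>sqrt (dist x y)\<close> the Lebesgue measure of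
  a ball of radius \<open>r\<close> is of order \<open>r ^ (2 * D)\<close>. Metrics induced by a norm on the ambient space, in
  particular the Euclidean one, satisfy it at every point.\<close>

definition norm_like_at :: "(real^'n) set \<Rightarrow> (real^'n \<Rightarrow> real^'n \<Rightarrow> real) \<Rightarrow> real^'n \<Rightarrow> bool" where
  "norm_like_at X d z \<longleftrightarrow>
     (\<exists>\<nu>. is_norm \<nu> \<and> ((\<lambda>x. d x z / \<nu> (x - z)) \<longlongrightarrow> 1) (at z within X))"

lemma norm_like_at_norm:
  assumes "is_norm \<nu>"
  shows "norm_like_at X (\<lambda>x y. \<nu> (x - y)) z"
proof -
  have "\<forall>\<^sub>F x in at z within X. \<nu> (x - z) / \<nu> (x - z) = 1"
    using assms by (auto simp: eventually_at_filter is_norm_def)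
  then show ?thesis
    unfolding norm_like_at_def by (intro exI[of _ \<nu>] conjI assms tendsto_eventually)
qed

lemma norm_like_at_dist: "norm_like_at X dist z"
proof -
  have "is_norm (norm :: real^'n \<Rightarrow> real)"
    by (auto simp: is_norm_def norm_triangle_ineq)
  then have "norm_like_at X (\<lambda>x y. norm (x - y)) z"
    by (rule norm_like_at_norm)
  then show ?thesis
    unfolding dist_norm[symmetric] .
qed


section \<open>The randomly applied perturbation\<close>

text \<open>The sample space is \<open>{0, 1} \<times> X\<close>; the first component is \<open>0\<close> with probability \<open>\<epsilon>\<close>.\<close>

definition noise :: "real \<Rightarrow> (real^'n) set \<Rightarrow> (nat \<times> (real^'n)) measure" where
  "noise \<epsilon> X =
     point_measure {0, 1} (\<lambda>\<eta>. ennreal (if \<eta> = 0 then \<epsilon> else 1 - \<epsilon>)) \<Otimes>\<^sub>M normalized_lebesgue X"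

definition perturbed_map :: "(real^'n \<Rightarrow> real^'n) \<Rightarrow> nat \<times> (real^'n) \<Rightarrow> real^'n \<Rightarrow> real^'n" where
  "perturbed_map f \<omega> x = real (fst \<omega>) *\<^sub>R f x + (1 - real (fst \<omega>)) *\<^sub>R snd \<omega>"

definition stationary :: "real \<Rightarrow> (real^'n) set \<Rightarrow> (real^'n \<Rightarrow> real^'n) \<Rightarrow> (real^'n) measure \<Rightarrow> bool" where
  "stationary \<epsilon> X f \<mu> \<longleftrightarrow>
     (\<forall>A\<in>sets \<mu>. emeasure \<mu> A =
        (\<integral>\<^sup>+x. (\<integral>\<^sup>+\<omega>. indicator A (perturbed_map f \<omega> x) \<partial>noise \<epsilon> X) \<partial>\<mu>))"

definition acsp_measure :: "real \<Rightarrow> (real^'n) set \<Rightarrow> (real^'n \<Rightarrow> real^'n) \<Rightarrow> (real^'n) measure \<Rightarrow> bool" where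
  "acsp_measure \<epsilon> X f \<mu> \<longleftrightarrow> prob_space \<mu> \<and> sets \<mu> = sets (normalized_lebesgue X) \<and>
     absolutely_continuous (normalized_lebesgue X) \<mu> \<and> stationary \<epsilon> X f \<mu>"

definition process_measure ::
  "real \<Rightarrow> (real^'n) set \<Rightarrow> (real^'n) measure \<Rightarrow> ((real^'n) \<times> (nat \<Rightarrow> nat \<times> (real^'n))) measure" where
  "process_measure \<epsilon> X \<mu> = \<mu> \<Otimes>\<^sub>M (\<Pi>\<^sub>M i\<in>UNIV. noise \<epsilon> X)"

definition h_density ::
  "real \<Rightarrow> (real^'n) set \<Rightarrow> (real^'n \<Rightarrow> real^'n) \<Rightarrow> (real^'n) set \<Rightarrow> real^'n \<Rightarrow> real" where
  "h_density \<epsilon> X f \<Delta> x =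
     \<epsilon> * (\<Sum>k. (1 - \<epsilon>) ^ k * Jac X f k x * indicator (Lam X f \<Delta> k) x)"

text \<open>Extended real valued, since the observable is infinite at \<open>z\<close> whereas \<open>ln 0 = 0\<close>.\<close>

definition neg_log_dist :: "('a \<Rightarrow> 'a \<Rightarrow> real) \<Rightarrow> 'a \<Rightarrow> 'a \<Rightarrow> ereal" where
  "neg_log_dist d z x = (if d x z = 0 then \<infinity> else ereal (- ln (d x z)))"

lemma Lam_Suc_subset:
  assumes "f \<in> X \<rightarrow> X"
  shows "Lam X f \<Delta> (Suc k) \<subseteq> Lam X f \<Delta> k"
  using assms by (induction k) auto

lemma Lam_antimono:
  assumes "f \<in> X \<rightarrow> X" "j \<le> k"
  shows "Lam X f \<Delta> k \<subseteq> Lam X f \<Delta> j"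
  using lift_Suc_antimono_le[of "Lam X f \<Delta>", OF Lam_Suc_subset[OF assms(1)] assms(2)] .

lemma h_density_eq_finite_sum:
  assumes "f \<in> X \<rightarrow> X" and "z \<in> Lam X f \<Delta> p" and "z \<notin> Lam X f \<Delta> (Suc p)"
  shows "h_density \<epsilon> X f \<Delta> z = \<epsilon> * (\<Sum>k=0..p. (1 - \<epsilon>) ^ k * Jac X f k z)"
proof -
  have in_Lam: "z \<in> Lam X f \<Delta> k \<longleftrightarrow> k \<le> p" for k
    using Lam_antimono[OF assms(1)] assms(2,3) by (meson not_less_eq_eq subsetD)
  have "(\<Sum>k. (1 - \<epsilon>) ^ k * Jac X f k z * indicator (Lam X f \<Delta> k) z) =
        (\<Sum>k=0..p. (1 - \<epsilon>) ^ k * Jac X f k z * indicator (Lam X f \<Delta> k) z)"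
    by (rule suminf_finite) (auto simp: in_Lam)
  also have "\<dots> = (\<Sum>k=0..p. (1 - \<epsilon>) ^ k * Jac X f k z)"
    by (rule sum.cong) (auto simp: in_Lam)
  finally show ?thesis
    by (simp add: h_density_def)
qed

end

theory Submission
  imports Defs
begin

text \<open>
  The event that the observable exceeds \<open>u\<^sub>n\<close> says that the initial point lies in the ball
  \<open>A\<^sub>n = B(z, t r\<^sub>n)\<close>, where \<open>r\<^sub>n = exp (- b\<^sub>n)\<close> and \<open>t = \<tau> powr (1 / D)\<close>. Hence the quantity in question
  is the product of

    \<^item> \<open>\<mu>(A\<^sub>n) / m(A\<^sub>n)\<close>,
    \<^item> \<open>m(A\<^sub>n) / m(B(z, r\<^sub>n))\<close>, and
    \<^item> \<open>n m(B(z, r\<^sub>n))\<close>, which equals \<open>1 / h\<^sub>\<epsilon>(z)\<close> by the choice of \<open>b\<^sub>n\<close>,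

  so it is enough that the first factor tends to \<open>h\<^sub>\<epsilon>(z)\<close> and the second to \<open>t\<^sup>D = \<tau>\<close>.

  The second limit (\<open>measure_mball_scaled_ratio\<close>) is geometric: as \<open>d\<close> agrees to first order with a
  norm at the interior point \<open>z\<close>, the volume of a small ball is asymptotically a constant times the
  \<open>D\<close>-th power of its radius.

  The first limit (\<open>stationary_measure_density\<close>) says that \<open>\<mu>\<close> has density \<open>h\<^sub>\<epsilon>(z)\<close> at \<open>z\<close>. Stationarity
  reads \<open>\<mu>(A) = \<epsilon> m(A) + (1 - \<epsilon>) \<mu>(f\<^sup>-\<^sup>1 A)\<close>; iterating it expresses \<open>\<mu>(A)\<close> through the volumes of the
  preimages of \<open>A\<close> up to order \<open>p\<close> and a remainder, the \<open>\<mu>\<close>-measure of its preimage of order \<open>p + 1\<close>.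
  The remainder vanishes when \<open>A\<close> is near \<open>z\<close>, since almost every orbit is in \<open>\<Lambda>\<^bsub>p+1\<^esub>\<close> at time \<open>p + 1\<close>
  and \<open>z\<close> is away from that set. The preimages in turn have volume asymptotic to \<open>J\<^sub>k(z) m(A)\<close>
  (\<open>iterated_preimage_ratio_tendsto_Jac\<close>), because \<open>f\<close> is a diffeomorphism near each of the points
  \<open>f\<^sup>-\<^sup>1 z\<close>, ..., \<open>f\<^sup>-\<^sup>k z\<close> and its Jacobian is continuous there.
\<close>

section \<open>Volume of differentiable images over a finite index type\<close>

text \<open>The change-of-variables bounds on \<open>real^'n\<close> assume a well-order on \<open>'n\<close>. A finite type need not
  carry one, but it is in bijection with an initial segment of the naturals, which does; the bounds
  are transported along that bijection.\<close>

typedef ('n::finite) idx = "{..<CARD('n)}"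
  by (rule exI[of _ 0]) (simp add: card_gt_0_iff)

setup_lifting type_definition_idx

instantiation idx :: (finite) linorder
begin
lift_definition less_eq_idx :: "'a idx \<Rightarrow> 'a idx \<Rightarrow> bool" is "(\<le>)" .
lift_definition less_idx :: "'a idx \<Rightarrow> 'a idx \<Rightarrow> bool" is "(<)" .
instance by standard (transfer; auto)+
end

instance idx :: (finite) finite
  by standard (simp add: type_definition.univ[OF type_definition_idx])

instance idx :: (finite) wellorder
proof -
  have "wf {(x :: 'a idx, y). x < y}"
    by (auto simp add: trancl_def tranclp_less intro!: finite_acyclic_wf acyclicI)
  thus "OFCLASS('a idx, wellorder_class)"
    by (rule wf_wellorderI) intro_classes
qed

lemma ex_bij_idx: "\<exists>\<phi> :: 'n::finite idx \<Rightarrow> 'n. bij \<phi>"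
proof -
  have "CARD('n idx) = CARD('n)"
    by (simp add: type_definition.card[OF type_definition_idx])
  then show ?thesis
    using finite_same_card_bij[of "UNIV :: 'n idx set" "UNIV :: 'n set"] by simp
qed

definition reindex :: "('k \<Rightarrow> 'n) \<Rightarrow> 'a^'n \<Rightarrow> 'a^'k" where
  "reindex \<phi> x = (\<chi> i. x $ \<phi> i)"

lemma reindex_nth [simp]: "reindex \<phi> x $ i = x $ \<phi> i"
  by (simp add: reindex_def)

lemma linear_reindex: "linear (reindex \<phi> :: real^'n \<Rightarrow> real^'k)"
  by (rule linearI) (auto simp: vec_eq_iff)

lemma reindex_inverse:
  assumes "bij \<phi>"
  shows "reindex (inv \<phi>) (reindex \<phi> x) = x" "reindex \<phi> (reindex (inv \<phi>) y) = y"
  using assms by (auto simp: vec_eq_iff bij_is_surj surj_f_inv_f bij_is_inj)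

text \<open>Conjugating by \<open>\<phi>\<close> is a sign-preserving bijection between the permutations of the two index
  types, so the two Leibniz expansions agree term by term.\<close>

lemma det_reindex:
  fixes A :: "real^'n^'n" and \<phi> :: "'k::finite \<Rightarrow> 'n"
  assumes \<phi>: "bij \<phi>"
  shows "det (\<chi> i j. A $ \<phi> i $ \<phi> j) = det A"
proof -
  let ?h = "map_permutation UNIV \<phi>"
  have inj: "inj \<phi>" and surj: "surj \<phi>" using \<phi> by (auto simp: bij_def)
  have h_apply: "?h q x = \<phi> (q (inv \<phi> x))" for q x
    using surj by (auto simp: map_permutation_def restrict_id_def)
  have bij_h: "bij_betw ?h {q. q permutes UNIV} {q. q permutes UNIV}"
  proof (rule bij_betwI[where g = "map_permutation UNIV (inv \<phi>)"])
    have iinv: "inv (inv \<phi>) = \<phi>" using \<phi> by (rule inv_inv_eq)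
    have r: "range (inv \<phi>) = UNIV" using bij_imp_bij_inv[OF \<phi>] bij_is_surj by blast
    have g_apply: "map_permutation UNIV (inv \<phi>) q x = inv \<phi> (q (\<phi> x))" for q x
      using iinv r by (auto simp: map_permutation_def restrict_id_def)
    show "?h \<in> {q. q permutes UNIV} \<rightarrow> {q. q permutes UNIV}"
      using map_permutation_permutes[of \<phi> UNIV UNIV] \<phi> by auto
    show "map_permutation UNIV (inv \<phi>) \<in> {q. q permutes UNIV} \<rightarrow> {q. q permutes UNIV}"
      using map_permutation_permutes[of "inv \<phi>" UNIV UNIV] bij_imp_bij_inv[OF \<phi>] by auto
    show "map_permutation UNIV (inv \<phi>) (?h q) = q" for q
      using inj by (auto simp: fun_eq_iff h_apply g_apply)
    show "?h (map_permutation UNIV (inv \<phi>) q) = q" for q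
      using surj by (auto simp: fun_eq_iff h_apply g_apply surj_f_inv_f)
  qed
  have "det A = (\<Sum>q | q permutes (UNIV::'k set). of_int (sign (?h q)) * (\<Prod>i\<in>UNIV. A $ i $ ?h q i))"
    unfolding det_def by (rule sum.reindex_bij_betw[OF bij_h, symmetric])
  also have "\<dots> = (\<Sum>q | q permutes (UNIV::'k set). of_int (sign q) * (\<Prod>i\<in>UNIV. A $ \<phi> i $ \<phi> (q i)))"
  proof (rule sum.cong[OF refl])
    fix q :: "'k \<Rightarrow> 'k" assume "q \<in> {q. q permutes UNIV}"
    then have "sign (?h q) = sign q"
      using inj by (intro sign_map_permutation) auto
    moreover have "(\<Prod>i\<in>UNIV. A $ i $ ?h q i) = (\<Prod>i\<in>UNIV. A $ \<phi> i $ ?h q (\<phi> i))"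
      by (rule prod.reindex_bij_betw[OF \<phi>, symmetric])
    ultimately show "of_int (sign (?h q)) * (\<Prod>i\<in>UNIV. A $ i $ ?h q i)
        = of_int (sign q) * (\<Prod>i\<in>UNIV. A $ \<phi> i $ \<phi> (q i))"
      using inj by (simp add: h_apply)
  qed
  finally show ?thesis by (simp add: det_def)
qed

text \<open>Renaming coordinates maps boxes to boxes with the same side lengths, and a Borel measure with
  the right values on boxes is Lebesgue measure.\<close>

lemma distr_lborel_reindex:
  fixes \<phi> :: "'k::finite \<Rightarrow> 'n::finite"
  assumes \<phi>: "bij \<phi>"
  shows "distr lborel borel (reindex \<phi>) = (lborel :: (real^'k) measure)"
proof (rule lborel_eqI[symmetric])
  have meas: "(reindex \<phi> :: real^'n \<Rightarrow> real^'k) \<in> borel_measurable borel"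
    by (intro borel_measurable_continuous_onI linear_continuous_on linear_conv_bounded_linear[THEN iffD1] linear_reindex)
  fix l u :: "real^'k"
  assume le: "\<And>b. b \<in> Basis \<Longrightarrow> l \<bullet> b \<le> u \<bullet> b"
  have le': "l $ i \<le> u $ i" for i
    using le[of "axis i 1"] by (auto simp: Basis_vec_def inner_axis)
  let ?r = "reindex (inv \<phi>) :: real^'k \<Rightarrow> real^'n"
  have vim: "reindex \<phi> -` box l u \<inter> space lborel = box (?r l) (?r u)"
  proof -
    have "(\<forall>i. l $ i < x $ \<phi> i \<and> x $ \<phi> i < u $ i) \<longleftrightarrow>
          (\<forall>j. l $ inv \<phi> j < x $ j \<and> x $ j < u $ inv \<phi> j)" for x :: "real^'n"
      using \<phi> by (metis bij_inv_eq_iff)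
    then show ?thesis by (auto simp: mem_box_cart)
  qed
  have prod: "(\<Prod>b\<in>Basis. (w - v) \<bullet> b) = (\<Prod>i\<in>UNIV. w $ i - v $ i)" for v w :: "real^'m"
  proof -
    have "bij_betw (\<lambda>i. axis i (1::real)) UNIV (Basis :: (real^'m) set)"
      by (auto simp: bij_betw_def inj_on_def axis_eq_axis Basis_vec_def)
    from prod.reindex_bij_betw[OF this, of "\<lambda>b. (w - v) \<bullet> b"] show ?thesis
      by (simp add: inner_axis)
  qed
  have "emeasure (distr lborel borel (reindex \<phi>)) (box l u) = emeasure lborel (box (?r l) (?r u))"
    using meas by (subst emeasure_distr) (auto simp: vim[simplified])
  also have "\<dots> = (\<Prod>b\<in>Basis. (?r u - ?r l) \<bullet> b)"
    using le' by (intro emeasure_lborel_box) (auto simp: Basis_vec_def inner_axis)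
  also have "(\<Prod>b\<in>Basis. (?r u - ?r l) \<bullet> b) = (\<Prod>b\<in>Basis. (u - l) \<bullet> b)"
    unfolding prod using prod.reindex_bij_betw[OF bij_imp_bij_inv[OF \<phi>], of "\<lambda>i. u $ i - l $ i"] by simp
  finally show "emeasure (distr lborel borel (reindex \<phi>)) (box l u) = (\<Prod>b\<in>Basis. (u - l) \<bullet> b)" .
qed auto

lemma lebesgue_reindex:
  fixes \<phi> :: "'k::finite \<Rightarrow> 'n::finite"
  assumes \<phi>: "bij \<phi>"
  shows "(reindex \<phi> :: real^'n \<Rightarrow> real^'k) \<in> lebesgue \<rightarrow>\<^sub>M lebesgue"
    and "distr lebesgue lebesgue (reindex \<phi>) = (lebesgue :: (real^'k) measure)"
proof -
  let ?R = "reindex \<phi> :: real^'n \<Rightarrow> real^'k"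
  have meas0: "?R \<in> lborel \<rightarrow>\<^sub>M lborel"
    using borel_measurable_continuous_onI[OF linear_continuous_on[OF linear_conv_bounded_linear[THEN iffD1, OF linear_reindex]], of \<phi>]
    by simp
  then have meas: "?R \<in> lebesgue \<rightarrow>\<^sub>M lborel" by (rule measurable_completion)
  have "distr lborel lborel ?R = distr lborel borel ?R" by (rule distr_cong) auto
  then have d: "distr lebesgue lborel ?R = lborel"
    using distr_completion[OF meas0] distr_lborel_reindex[OF \<phi>] by metis
  show "?R \<in> lebesgue \<rightarrow>\<^sub>M lebesgue"
    by (rule completion.measurable_completion2[OF meas]) (simp add: d)
  show "distr lebesgue lebesgue ?R = lebesgue"
    using completion.completion_distr_eq[OF meas] d by simp
qed

lemma
  fixes \<phi> :: "'k::finite \<Rightarrow> 'n::finite" and S :: "(real^'n) set"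
  assumes \<phi>: "bij \<phi>" and S: "S \<in> lmeasurable"
  shows lmeasurable_reindex_image: "reindex \<phi> ` S \<in> lmeasurable"
    and measure_reindex_image: "measure lebesgue (reindex \<phi> ` S) = measure lebesgue S"
proof -
  let ?R = "reindex \<phi> :: real^'n \<Rightarrow> real^'k" and ?Q = "reindex (inv \<phi>) :: real^'k \<Rightarrow> real^'n"
  have im: "?R ` S = ?Q -` S"
    by (auto simp: image_iff reindex_inverse[OF \<phi>] intro!: bexI[where x = "?Q _"])
  note Q = lebesgue_reindex[OF bij_imp_bij_inv[OF \<phi>]]
  have sets: "?R ` S \<in> sets lebesgue"
    unfolding im using measurable_sets[OF Q(1), of S] S by auto
  have "emeasure lebesgue (?R ` S) = emeasure (distr lebesgue lebesgue ?Q) S"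
    unfolding im using Q(1) S by (subst emeasure_distr) auto
  then have e: "emeasure lebesgue (?R ` S) = emeasure lebesgue S"
    by (simp add: Q(2))
  show "?R ` S \<in> lmeasurable"
    using sets e S by (intro fmeasurableI) (auto simp: fmeasurable_def)
  show "measure lebesgue (?R ` S) = measure lebesgue S"
    by (simp add: measure_def e)
qed

lemma matrix_reindex_conjugate:
  fixes \<phi> :: "'k::finite \<Rightarrow> 'n::finite" and L :: "real^'n \<Rightarrow> real^'n"
  assumes "bij \<phi>"
  shows "matrix (\<lambda>y. reindex \<phi> (L (reindex (inv \<phi>) y))) = (\<chi> i j. matrix L $ \<phi> i $ \<phi> j)"
proof -
  have *: "reindex (inv \<phi>) (axis j (1::real)) = axis (\<phi> j) 1" for j
    using bij_inv_eq_iff[OF assms] inv_f_f[OF bij_is_inj[OF assms]] by (auto simp: vec_eq_iff axis_def)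
  show ?thesis by (simp add: matrix_def * vec_eq_iff)
qed

text \<open>Conjugating \<open>f\<close> with the coordinate renaming changes neither volumes nor Jacobian determinants,
  so the bound for well-ordered index types holds for every finite index type. This one-sided bound
  is all the change of variables needed below: applied to a diffeomorphism and to its inverse it
  pinches the volume of small images from both sides.\<close>

lemma
  fixes f :: "real^'n::finite \<Rightarrow> real^'n"
  assumes S: "S \<in> lmeasurable"
    and deriv: "\<And>x. x \<in> S \<Longrightarrow> (f has_derivative f' x) (at x within S)"
    and bounded: "\<And>x. x \<in> S \<Longrightarrow> \<bar>det (matrix (f' x))\<bar> \<le> B"
  shows lmeasurable_image_bounded_det: "f ` S \<in> lmeasurable"
    and measure_image_bounded_det: "measure lebesgue (f ` S) \<le> B * measure lebesgue S"
proof -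
  obtain \<phi> :: "'n idx \<Rightarrow> 'n" where \<phi>: "bij \<phi>" using ex_bij_idx by blast
  let ?R = "reindex \<phi> :: real^'n \<Rightarrow> real^'n idx" and ?Q = "reindex (inv \<phi>) :: real^'n idx \<Rightarrow> real^'n"
  note inv = reindex_inverse[OF \<phi>]
  define F where "F y = ?R (f (?Q y))" for y
  define F' where "F' y = (\<lambda>v. ?R (f' (?Q y) (?Q v)))" for y
  have S': "?R ` S \<in> lmeasurable" by (rule lmeasurable_reindex_image[OF \<phi> S])
  have blR: "bounded_linear ?R" and blQ: "bounded_linear ?Q"
    by (auto simp: linear_reindex simp flip: linear_conv_bounded_linear)
  have QR: "?Q ` ?R ` S = S" by (simp add: image_image inv)
  have der: "(F has_derivative F' y) (at y within ?R ` S)" if "y \<in> ?R ` S" for y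
  proof -
    have y: "?Q y \<in> S" using that by (auto simp: inv)
    have "((\<lambda>y. f (?Q y)) has_derivative (\<lambda>v. f' (?Q y) (?Q v))) (at y within ?R ` S)"
      using has_derivative_in_compose[of ?Q ?Q y "?R ` S" f "f' (?Q y)"]
        bounded_linear_imp_has_derivative[OF blQ] deriv[OF y] QR by auto
    from bounded_linear.has_derivative[OF blR this] show ?thesis
      unfolding F_def F'_def .
  qed
  have det: "\<bar>det (matrix (F' y))\<bar> \<le> B" if "y \<in> ?R ` S" for y
    using that bounded
    by (auto simp: F'_def inv matrix_reindex_conjugate[OF \<phi>] det_reindex[OF \<phi>])
  \<comment> \<open>A Jacobian determinant is measurable; being bounded on a set of finite measure, it is integrable.\<close>
  have int: "(\<lambda>y. \<bar>det (matrix (F' y))\<bar>) integrable_on ?R ` S"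
  proof (rule measurable_bounded_by_integrable_imp_integrable)
    show "(\<lambda>y. \<bar>det (matrix (F' y))\<bar>) \<in> borel_measurable (lebesgue_on (?R ` S))"
      using borel_measurable_det_Jacobian[OF _ der] S' by (intro borel_measurable_abs) auto
    show "(\<lambda>_. B) integrable_on ?R ` S"
      using S' by (simp add: integrable_on_const)
  qed (use S' det in auto)
  note F = measurable_bounded_differentiable_image[OF S' der int det]
    measure_bounded_differentiable_image[OF S' der int det]
  have QF: "?Q ` F ` ?R ` S = f ` S"
    by (simp add: F_def image_image inv)
  note bi = bij_imp_bij_inv[OF \<phi>]
  show "f ` S \<in> lmeasurable"
    using lmeasurable_reindex_image[OF bi F(1)] QF by simp
  show "measure lebesgue (f ` S) \<le> B * measure lebesgue S"
    using F(2) measure_reindex_image[OF bi F(1)] measure_reindex_image[OF \<phi> S] QF by simp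
qed

section \<open>Volume of small metric balls\<close>

lemma is_norm_continuous:
  fixes \<nu> :: "real^'n \<Rightarrow> real"
  assumes "is_norm \<nu>"
  shows "continuous_on UNIV \<nu>"
proof -
  have nn: "0 \<le> \<nu> x" and sc: "\<nu> (c *\<^sub>R x) = \<bar>c\<bar> * \<nu> x" and tri: "\<nu> (x + y) \<le> \<nu> x + \<nu> y"
    and zero: "\<nu> 0 = 0" for c x y
    using assms by (auto simp: is_norm_def)
  define C where "C = (\<Sum>b\<in>Basis. \<nu> b)"
  have sum_le: "\<nu> (\<Sum>b\<in>A. g b) \<le> (\<Sum>b\<in>A. \<nu> (g b))" if "finite A" for A :: "(real^'n) set" and g
    using that by (induction A rule: finite_induct) (auto simp: zero intro: order_trans[OF tri])
  have bound: "\<nu> x \<le> C * norm x" for x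
  proof -
    have "\<nu> x = \<nu> (\<Sum>b\<in>Basis. (x \<bullet> b) *\<^sub>R b)" by (simp add: euclidean_representation)
    also have "\<dots> \<le> (\<Sum>b\<in>Basis. \<nu> ((x \<bullet> b) *\<^sub>R b))" by (rule sum_le) simp
    also have "\<dots> \<le> (\<Sum>b\<in>Basis. norm x * \<nu> b)"
      by (intro sum_mono) (auto simp: sc Basis_le_norm intro!: mult_right_mono nn)
    finally show ?thesis by (simp add: C_def sum_distrib_left mult.commute)
  qed
  have "\<bar>\<nu> x - \<nu> y\<bar> \<le> C * dist x y" for x y
    using tri[of "x - y" y] tri[of "y - x" x] bound[of "x - y"] bound[of "y - x"]
    by (simp add: dist_norm norm_minus_commute)
  then have "C-lipschitz_on UNIV \<nu>"
    by (intro lipschitz_onI) (auto simp: dist_real_def C_def intro: sum_nonneg nn)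
  then show ?thesis by (rule lipschitz_on_continuous_on)
qed

text \<open>Equivalence with the Euclidean norm: the norm attains a positive minimum on the compact unit
  sphere, and homogeneity spreads the bound to all vectors.\<close>

lemma is_norm_lower_bound:
  fixes \<nu> :: "real^'n \<Rightarrow> real"
  assumes "is_norm \<nu>"
  obtains c where "0 < c" "\<And>x. c * norm x \<le> \<nu> x"
proof -
  have nn: "0 \<le> \<nu> x" and sc: "\<nu> (c *\<^sub>R x) = \<bar>c\<bar> * \<nu> x"
    and zero: "\<nu> x = 0 \<longleftrightarrow> x = 0" for c x
    using assms by (auto simp: is_norm_def)
  obtain b :: "real^'n" where "b \<in> Basis" using nonempty_Basis by blast
  then have "sphere (0::real^'n) 1 \<noteq> {}" by (auto intro!: exI[of _ b])
  then obtain x0 where x0: "x0 \<in> sphere 0 1" "\<And>x. x \<in> sphere 0 1 \<Longrightarrow> \<nu> x0 \<le> \<nu> x"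
    using continuous_attains_inf[of "sphere (0::real^'n) 1" \<nu>]
      continuous_on_subset[OF is_norm_continuous[OF assms]] by auto
  show thesis
  proof
    have "x0 \<noteq> 0" using x0(1) by auto
    then show "0 < \<nu> x0" using nn[of x0] zero[of x0] by linarith
    show "\<nu> x0 * norm x \<le> \<nu> x" for x
    proof (cases "x = 0")
      case False
      then have "\<nu> x0 \<le> \<nu> ((1 / norm x) *\<^sub>R x)" by (intro x0(2)) simp
      then show ?thesis using False by (simp add: sc field_simps)
    qed (use nn in auto)
  qed
qed

definition norm_ball :: "('a::real_vector \<Rightarrow> real) \<Rightarrow> 'a \<Rightarrow> real \<Rightarrow> 'a set" where
  "norm_ball \<nu> z r = {x. \<nu> (x - z) < r}"

lemma open_norm_ball:
  fixes \<nu> :: "real^'n \<Rightarrow> real"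
  assumes "is_norm \<nu>"
  shows "open (norm_ball \<nu> z r)"
proof -
  have "continuous_on UNIV (\<lambda>x. \<nu> (x - z))"
    by (rule continuous_on_compose2[OF is_norm_continuous[OF assms]]) (auto intro!: continuous_intros)
  then show ?thesis unfolding norm_ball_def
    by (rule open_Collect_less[OF _ continuous_on_const])
qed

lemma norm_ball_subset_ball:
  fixes \<nu> :: "real^'n \<Rightarrow> real"
  assumes "is_norm \<nu>" "0 < e"
  obtains r0 where "0 < r0" "\<And>z. norm_ball \<nu> z r0 \<subseteq> ball z e"
proof -
  obtain c where c: "0 < c" "\<And>x. c * norm x \<le> \<nu> x" using is_norm_lower_bound[OF assms(1)] by blast
  show thesis
  proof
    show "0 < c * e" using c assms by simp
    show "norm_ball \<nu> z (c * e) \<subseteq> ball z e" for z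
    proof
      fix x assume "x \<in> norm_ball \<nu> z (c * e)"
      then have "c * norm (x - z) < c * e" using c(2)[of "x - z"] by (simp add: norm_ball_def)
      then show "x \<in> ball z e" using c(1) by (simp add: dist_norm norm_minus_commute)
    qed
  qed
qed

lemma lmeasurable_norm_ball:
  fixes \<nu> :: "real^'n \<Rightarrow> real"
  assumes "is_norm \<nu>"
  shows "norm_ball \<nu> z r \<in> lmeasurable"
proof -
  obtain c where c: "0 < c" "\<And>x. c * norm x \<le> \<nu> x" using is_norm_lower_bound[OF assms(1)] by blast
  have "norm_ball \<nu> z r \<subseteq> cball z (r / c)"
  proof
    fix x assume "x \<in> norm_ball \<nu> z r"
    then have "c * norm (x - z) < r" using c(2)[of "x - z"] by (simp add: norm_ball_def)
    then show "x \<in> cball z (r / c)" using c(1) by (simp add: dist_norm norm_minus_commute field_simps)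
  qed
  then have "bounded (norm_ball \<nu> z r)" using bounded_cball bounded_subset by blast
  then show ?thesis using open_norm_ball[OF assms] by (rule lmeasurable_open)
qed

lemma measure_norm_ball:
  fixes \<nu> :: "real^'n \<Rightarrow> real"
  assumes "is_norm \<nu>" "0 \<le> r"
  shows "measure lebesgue (norm_ball \<nu> z r) = r ^ CARD('n) * measure lebesgue (norm_ball \<nu> 0 1)"
proof (cases "r = 0")
  case True
  then have "norm_ball \<nu> z r = {}" using assms(1) by (auto simp: is_norm_def norm_ball_def not_less)
  then show ?thesis using True by simp
next
  case False
  then have r: "r > 0" using assms by simp
  have sc: "\<nu> (c *\<^sub>R x) = \<bar>c\<bar> * \<nu> x" for c x
    using assms by (auto simp: is_norm_def)
  have "norm_ball \<nu> z r = (\<lambda>x. r *\<^sub>R x + z) ` norm_ball \<nu> 0 1"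
  proof (intro equalityI subsetI)
    fix x assume "x \<in> norm_ball \<nu> z r"
    then have "\<nu> (x - z) < r" by (simp add: norm_ball_def)
    then have "\<nu> ((1 / r) *\<^sub>R (x - z)) < 1" unfolding sc using r by simp
    then have "(1 / r) *\<^sub>R (x - z) \<in> norm_ball \<nu> 0 1" by (simp add: norm_ball_def)
    moreover have "x = r *\<^sub>R ((1 / r) *\<^sub>R (x - z)) + z" using r by simp
    ultimately show "x \<in> (\<lambda>x. r *\<^sub>R x + z) ` norm_ball \<nu> 0 1" by blast
  qed (use r in \<open>auto simp: norm_ball_def sc\<close>)
  then show ?thesis using measure_lebesgue_affine[of r z "norm_ball \<nu> 0 1"] r by simp
qed

lemma measure_norm_ball_pos:
  fixes \<nu> :: "real^'n \<Rightarrow> real"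
  assumes "is_norm \<nu>" "0 < r"
  shows "0 < measure lebesgue (norm_ball \<nu> z r)"
proof -
  have "\<nu> 0 = 0" using assms(1) by (simp add: is_norm_def)
  then have "z \<in> norm_ball \<nu> z r" using assms(2) by (simp add: norm_ball_def)
  then have "norm_ball \<nu> z r \<notin> null_sets lebesgue"
    using open_norm_ball[OF assms(1)] open_not_negligible by (metis empty_iff negligible_iff_null_sets)
  then show ?thesis
    using lmeasurable_norm_ball[OF assms(1), of z r]
    by (metis completion.complete_measure_axioms fmeasurableD2 measure_nonneg emeasure_eq_ennreal_measure
        ennreal_0 fmeasurableD less_eq_real_def null_setsI top.not_eq_extremum)
qed

text \<open>For radii \<open>r\<close> small enough a \<open>d\<close>-ball lies between the \<open>\<nu>\<close>-balls of radii \<open>r / (1 + \<delta>)\<close> and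
  \<open>r / (1 - \<delta>)\<close>, whose volumes scale exactly; then \<open>\<delta>\<close> tends to 0. That \<open>d\<close> induces the Euclidean
  topology guarantees that small \<open>d\<close>-balls lie in the region where the first-order comparison of
  \<open>d\<close> with \<open>\<nu>\<close> is valid; that \<open>z\<close> is interior guarantees that small \<open>\<nu>\<close>-balls lie in \<open>X\<close>.\<close>

lemma measure_mball_over_power_tendsto:
  fixes \<nu> :: "real^'n \<Rightarrow> real"
  assumes \<nu>: "is_norm \<nu>" and lim: "((\<lambda>x. d x z / \<nu> (x - z)) \<longlongrightarrow> 1) (at z within X)"
    and M: "Metric_space X d" and top: "Metric_space.mtopology X d = top_of_set X"
    and X: "X \<in> sets lebesgue" and z: "z \<in> interior X"
  shows "((\<lambda>r. measure lebesgue (Metric_space.mball X d z r) / r ^ CARD('n))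
      \<longlongrightarrow> measure lebesgue (norm_ball \<nu> 0 1)) (at_right 0)"
proof -
  interpret Metric_space X d by fact
  let ?D = "CARD('n)" and ?c = "measure lebesgue (norm_ball \<nu> 0 1)"
  let ?q = "\<lambda>r. measure lebesgue (mball z r) / r ^ ?D"
  have zX: "z \<in> X" using z interior_subset by blast
  have zero: "\<nu> x = 0 \<longleftrightarrow> x = 0" and nn: "0 \<le> \<nu> x" for x using \<nu> by (auto simp: is_norm_def)
  have sets: "mball z r \<in> sets lebesgue" for r
  proof -
    have "openin (top_of_set X) (mball z r)" using openin_mball[of z r] unfolding top .
    then show ?thesis using X by (auto simp: openin_open intro!: sets.Int)
  qed
  have sandwich: "\<forall>\<^sub>F r in at_right 0. ?c / (1 + \<delta>) ^ ?D \<le> ?q r \<and> ?q r \<le> ?c / (1 - \<delta>) ^ ?D"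
    if \<delta>: "0 < \<delta>" "\<delta> < 1" for \<delta>
  proof -
    obtain e1 where e1: "0 < e1" "\<And>x. x \<in> X \<Longrightarrow> x \<noteq> z \<Longrightarrow> dist x z < e1 \<Longrightarrow> \<bar>d x z / \<nu> (x - z) - 1\<bar> < \<delta>"
      using tendstoD[OF lim \<delta>(1)] unfolding eventually_at dist_real_def by blast
    obtain e2 where e2: "0 < e2" "ball z e2 \<subseteq> X" using z by (auto simp: mem_interior)
    \<comment> \<open>On the Euclidean ball of radius \<open>e\<close>, both the comparison of \<open>d\<close> with \<open>\<nu>\<close> and membership in \<open>X\<close>
      are available.\<close>
    define e where "e = min e1 e2"
    have e: "0 < e" "ball z e \<subseteq> X" using e1(1) e2 by (auto simp: e_def)
    have near: "(1 - \<delta>) * \<nu> (x - z) \<le> d z x \<and> d z x \<le> (1 + \<delta>) * \<nu> (x - z)" if "x \<in> ball z e" for x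
    proof (cases "x = z")
      case False
      have xX: "x \<in> X" using that e(2) by auto
      have pos: "0 < \<nu> (x - z)" using False zero[of "x - z"] nn[of "x - z"] by simp
      have "\<bar>d x z / \<nu> (x - z) - 1\<bar> < \<delta>"
        using that xX False by (intro e1(2)) (auto simp: e_def dist_commute)
      then have "1 - \<delta> < d x z / \<nu> (x - z)" "d x z / \<nu> (x - z) < 1 + \<delta>" by linarith+
      then show ?thesis using pos commute by (simp add: field_simps)
    qed (use zero[of 0] zX in simp)
    obtain r1 where r1: "0 < r1" "\<And>z. norm_ball \<nu> z r1 \<subseteq> ball z e"
      using norm_ball_subset_ball[OF \<nu> e(1)] by blast
    have "openin mtopology (ball z e)"
      unfolding top using e(2) by (simp add: open_openin_trans open_subset)
    then obtain r2 where r2: "0 < r2" "mball z r2 \<subseteq> ball z e"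
      using e(1) unfolding openin_mtopology by (metis centre_in_ball)
    have "?c / (1 + \<delta>) ^ ?D \<le> ?q r \<and> ?q r \<le> ?c / (1 - \<delta>) ^ ?D" if r: "0 < r" "r < min r1 r2" for r
    proof -
      have "norm_ball \<nu> z (r / (1 + \<delta>)) \<subseteq> mball z r"
      proof
        fix x assume x: "x \<in> norm_ball \<nu> z (r / (1 + \<delta>))"
        have "r / (1 + \<delta>) \<le> r" using r \<delta> by (simp add: field_simps)
        then have "x \<in> norm_ball \<nu> z r1" using x r by (auto simp: norm_ball_def)
        then have xb: "x \<in> ball z e" using r1(2) by blast
        moreover have "(1 + \<delta>) * \<nu> (x - z) < r" using x \<delta> by (simp add: norm_ball_def field_simps)
        ultimately show "x \<in> mball z r" using near[OF xb] zX e(2) by auto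
      qed
      then have "measure lebesgue (norm_ball \<nu> z (r / (1 + \<delta>))) \<le> measure lebesgue (mball z r)"
        if "mball z r \<in> lmeasurable"
        using that by (intro measure_mono_fmeasurable fmeasurableD lmeasurable_norm_ball \<nu>)
      moreover have sub: "mball z r \<subseteq> norm_ball \<nu> z (r / (1 - \<delta>))"
      proof
        fix x assume x: "x \<in> mball z r"
        then have "x \<in> mball z r2" using r by auto
        then have xb: "x \<in> ball z e" using r2(2) by blast
        have "(1 - \<delta>) * \<nu> (x - z) < r" using near[OF xb] x by auto
        then show "x \<in> norm_ball \<nu> z (r / (1 - \<delta>))" using \<delta> by (simp add: norm_ball_def field_simps)
      qed
      moreover have lm: "mball z r \<in> lmeasurable"
        using fmeasurableI2[OF lmeasurable_norm_ball[OF \<nu>] sub sets] .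
      moreover have "measure lebesgue (mball z r) \<le> measure lebesgue (norm_ball \<nu> z (r / (1 - \<delta>)))"
        using sub sets by (intro measure_mono_fmeasurable lmeasurable_norm_ball \<nu>)
      moreover have "0 \<le> r / (1 + \<delta>)" "0 \<le> r / (1 - \<delta>)" using r \<delta> by auto
      ultimately show ?thesis
        using r \<delta> by (simp add: measure_norm_ball[OF \<nu>, of _ z] power_divide field_simps)
    qed
    then show ?thesis
      unfolding eventually_at_right_field using r1(1) r2(1) by (intro exI[of _ "min r1 r2"]) auto
  qed
  have tp: "((\<lambda>\<delta>. ?c / (1 + \<delta>) ^ ?D) \<longlongrightarrow> ?c) (at_right 0)" "((\<lambda>\<delta>. ?c / (1 - \<delta>) ^ ?D) \<longlongrightarrow> ?c) (at_right 0)"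
    by (auto intro!: tendsto_eq_intros)
  have small: "\<forall>\<^sub>F \<delta> in at_right (0::real). 0 < \<delta> \<and> \<delta> < 1"
    unfolding eventually_at_right_field by (intro exI[of _ 1]) auto
  show ?thesis
  proof (rule order_tendstoI)
    fix a assume "a < ?c"
    then have "\<forall>\<^sub>F \<delta> in at_right 0. a < ?c / (1 + \<delta>) ^ ?D" using order_tendstoD(1)[OF tp(1)] by blast
    with small have "\<forall>\<^sub>F \<delta> in at_right 0. (0 < \<delta> \<and> \<delta> < 1) \<and> a < ?c / (1 + \<delta>) ^ ?D" by (rule eventually_conj)
    then obtain \<delta> where "0 < \<delta>" "\<delta> < 1" "a < ?c / (1 + \<delta>) ^ ?D"
      using eventually_happens'[OF trivial_limit_at_right_real] by blast
    with sandwich[of \<delta>] show "\<forall>\<^sub>F r in at_right 0. a < ?q r" by (auto elim!: eventually_mono)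
  next
    fix a assume "?c < a"
    then have "\<forall>\<^sub>F \<delta> in at_right 0. ?c / (1 - \<delta>) ^ ?D < a" using order_tendstoD(2)[OF tp(2)] by blast
    with small have "\<forall>\<^sub>F \<delta> in at_right 0. (0 < \<delta> \<and> \<delta> < 1) \<and> ?c / (1 - \<delta>) ^ ?D < a" by (rule eventually_conj)
    then obtain \<delta> where "0 < \<delta>" "\<delta> < 1" "?c / (1 - \<delta>) ^ ?D < a"
      using eventually_happens'[OF trivial_limit_at_right_real] by blast
    with sandwich[of \<delta>] show "\<forall>\<^sub>F r in at_right 0. ?q r < a" by (auto elim!: eventually_mono)
  qed
qed

lemma measure_mball_scaled_ratio:
  fixes z :: "real^'n" and r :: "nat \<Rightarrow> real"
  assumes nl: "norm_like_at X d z"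
    and M: "Metric_space X d" and top: "Metric_space.mtopology X d = top_of_set X"
    and X: "X \<in> sets lebesgue" and z: "z \<in> interior X"
    and t: "0 < t" and r: "r \<longlonglongrightarrow> 0" "\<And>n. 0 < r n"
  shows "(\<lambda>n. measure lebesgue (Metric_space.mball X d z (t * r n))
       / measure lebesgue (Metric_space.mball X d z (r n))) \<longlonglongrightarrow> t ^ CARD('n)"
proof -
  obtain \<nu> where \<nu>: "is_norm \<nu>" and lim: "((\<lambda>x. d x z / \<nu> (x - z)) \<longlongrightarrow> 1) (at z within X)"
    using nl by (auto simp: norm_like_at_def)
  let ?c = "measure lebesgue (norm_ball \<nu> 0 1)" and ?m = "\<lambda>r. measure lebesgue (Metric_space.mball X d z r)"
  have c: "0 < ?c" by (rule measure_norm_ball_pos[OF \<nu>]) simp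
  note T = measure_mball_over_power_tendsto[OF \<nu> lim M top X z]
  have fr: "filterlim r (at_right 0) sequentially"
    using r by (auto simp: filterlim_at less_imp_neq[THEN not_sym])
  have "(\<lambda>n. t * r n) \<longlonglongrightarrow> 0" using tendsto_mult_left[OF r(1), of t] by simp
  then have ftr: "filterlim (\<lambda>n. t * r n) (at_right 0) sequentially"
    using r(2) t by (auto simp: filterlim_at less_imp_neq[THEN not_sym])
  have "(\<lambda>n. t ^ CARD('n) * ((?m (t * r n) / (t * r n) ^ CARD('n)) / (?m (r n) / r n ^ CARD('n)))) \<longlonglongrightarrow> t ^ CARD('n) * (?c / ?c)"
    using c by (intro tendsto_intros filterlim_compose[OF T fr] filterlim_compose[OF T ftr]) auto
  moreover have "t ^ CARD('n) * ((?m (t * r n) / (t * r n) ^ CARD('n)) / (?m (r n) / r n ^ CARD('n))) = ?m (t * r n) / ?m (r n)" for n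
    using t r(2)[of n] by (simp add: power_mult_distrib field_simps)
  ultimately show ?thesis using c by simp
qed

lemma mball_in_sets:
  assumes "Metric_space X d" "Metric_space.mtopology X d = top_of_set X" "X \<in> sets lebesgue"
  shows "Metric_space.mball X d z r \<in> sets lebesgue"
proof -
  interpret Metric_space X d by fact
  have "openin (top_of_set X) (mball z r)" using openin_mball[of z r] unfolding assms(2) .
  then show ?thesis using assms(3) by (auto simp: openin_open intro!: sets.Int)
qed

text \<open>Near an interior point the relative topology of \<open>X\<close> is that of the whole space, so the ball
  contains a nonempty open set.\<close>

lemma measure_mball_pos:
  assumes M: "Metric_space X d" and top: "Metric_space.mtopology X d = top_of_set X"
    and X: "X \<in> lmeasurable" and z: "z \<in> interior X" and r: "0 < r"
  shows "0 < measure lebesgue (Metric_space.mball X d z r)"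
proof -
  interpret Metric_space X d by fact
  have op: "openin (top_of_set X) (mball z r)" using openin_mball[of z r] unfolding top .
  then obtain T where T: "open T" "mball z r = X \<inter> T" by (auto simp: openin_open)
  have "z \<in> X" using z interior_subset by blast
  then have "z \<in> mball z r" using r by simp
  then have "interior X \<inter> T \<noteq> {}" "open (interior X \<inter> T)" using z T by auto
  then have "\<not> negligible (interior X \<inter> T)" by (rule open_not_negligible[rotated])
  moreover have "interior X \<inter> T \<subseteq> mball z r" using T interior_subset by auto
  ultimately have "\<not> negligible (mball z r)" using negligible_subset by blast
  moreover have "mball z r \<in> lmeasurable"
    using mball_in_sets[OF M top] X by (intro fmeasurableI2[OF X mball_subset_mspace]) auto
  ultimately show ?thesis
    by (metis measure_nonneg less_eq_real_def negligible_iff_measure)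
qed

section \<open>Volume of iterated preimages of shrinking sets\<close>

text \<open>The conditions hold eventually rather than always because they have to be inherited by
  preimages, which are well behaved only once the sets have entered the range of the map.\<close>

definition shrinks_to :: "(nat \<Rightarrow> (real^'n) set) \<Rightarrow> real^'n \<Rightarrow> bool" where
  "shrinks_to S z \<longleftrightarrow>
     (\<forall>\<^sub>F n in sequentially. S n \<in> lmeasurable \<and> 0 < measure lebesgue (S n)) \<and>
     (\<forall>W. open W \<longrightarrow> z \<in> W \<longrightarrow> (\<forall>\<^sub>F n in sequentially. S n \<subseteq> W))"

lemma shrinks_toD:
  assumes "shrinks_to S z"
  shows "\<forall>\<^sub>F n in sequentially. S n \<in> lmeasurable"
    and "\<forall>\<^sub>F n in sequentially. 0 < measure lebesgue (S n)"
    and "open W \<Longrightarrow> z \<in> W \<Longrightarrow> \<forall>\<^sub>F n in sequentially. S n \<subseteq> W"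
  using assms unfolding shrinks_to_def by (simp_all add: eventually_conj_iff)

abbreviation Jdet :: "(real^'n \<Rightarrow> real^'n) \<Rightarrow> real^'n \<Rightarrow> real" where
  "Jdet f x \<equiv> \<bar>det (matrix (frechet_derivative f (at x)))\<bar>"

lemma C1_onD:
  assumes "C1_on f U" "x \<in> U"
  shows "(f has_derivative frechet_derivative f (at x)) (at x)"
  using assms by (simp add: C1_on_def frechet_derivative_works)

lemma C1_on_imp_continuous_on: "C1_on f U \<Longrightarrow> continuous_on U f"
  by (meson C1_on_def continuous_at_imp_continuous_on differentiable_imp_continuous_within)

lemma continuous_on_Jdet:
  assumes "C1_on f U"
  shows "continuous_on U (Jdet f)"
proof -
  have c: "continuous_on U (\<lambda>x. matrix (frechet_derivative f (at x)))"
    using assms by (simp add: C1_on_def)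
  then show ?thesis
    unfolding det_def by (intro continuous_intros)
qed

lemma Jdet_left_inverse:
  assumes U: "open U" and f: "C1_on f U" and g: "C1_on g (f ` U)"
    and gf: "\<And>x. x \<in> U \<Longrightarrow> g (f x) = x" and x: "x \<in> U"
  shows "Jdet g (f x) * Jdet f x = 1"
proof -
  let ?F = "frechet_derivative f (at x)" and ?G = "frechet_derivative g (at (f x))"
  have F: "(f has_derivative ?F) (at x)" by (rule C1_onD[OF f x])
  have G: "(g has_derivative ?G) (at (f x))" using x by (intro C1_onD[OF g]) auto
  have "(g \<circ> f has_derivative ?G \<circ> ?F) (at x)" by (rule diff_chain_at[OF F G])
  then have "((\<lambda>x. x) has_derivative ?G \<circ> ?F) (at x)"
    by (rule has_derivative_transform_within_open[OF _ U x]) (simp add: gf)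
  then have "?G \<circ> ?F = (\<lambda>x. x)" using has_derivative_unique has_derivative_ident by blast
  moreover have "matrix (?G \<circ> ?F) = matrix ?G ** matrix ?F"
    using F G by (intro matrix_compose) (auto dest: has_derivative_linear)
  ultimately have "matrix ?G ** matrix ?F = mat 1"
    using matrix_id_mat_1[unfolded id_def] by metis
  then have "det (matrix ?G) * det (matrix ?F) = 1"
    by (metis det_I det_mul)
  then show ?thesis by (simp flip: abs_mult)
qed

text \<open>The local volume distortion of an inverse branch. Once \<open>S n\<close> is close to \<open>f x0\<close>, its preimage is
  \<open>g ` S n\<close> for the inverse \<open>g\<close>, so an upper bound for the Jacobian of \<open>g\<close> bounds the ratio from
  above; and \<open>S n\<close> is in turn the image of the preimage under \<open>f\<close>, so an upper bound for the Jacobian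
  of \<open>f\<close> bounds the ratio from below. By continuity both bounds come arbitrarily close to the
  value at the point. The second claim is what allows the result to be iterated.\<close>

lemma shrinks_to_preimage:
  fixes f :: "real^'n \<Rightarrow> real^'n"
  assumes diff: "C1_diffeo_on f U" and x0: "x0 \<in> U" and S: "shrinks_to S (f x0)"
  shows "(\<lambda>n. measure lebesgue {x \<in> U. f x \<in> S n} / measure lebesgue (S n)) \<longlonglongrightarrow> inverse (Jdet f x0)" (is ?ratio)
    and "shrinks_to (\<lambda>n. {x \<in> U. f x \<in> S n}) x0"
proof -
  obtain g where U: "open U" and fU: "open (f ` U)" and f: "C1_on f U" and g: "C1_on g (f ` U)"
    and gf: "\<And>x. x \<in> U \<Longrightarrow> g (f x) = x"
    using diff unfolding C1_diffeo_on_def by blast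
  let ?m = "measure lebesgue" and ?T = "\<lambda>n. {x \<in> U. f x \<in> S n}"
  have near: "\<forall>\<^sub>F n in sequentially. S n \<subseteq> W" if "open W" "f x0 \<in> W" for W
    using shrinks_toD(3)[OF S that] .
  have T_eq: "?T n = g ` S n" if "S n \<subseteq> f ` U" for n
    using that gf by (force simp: image_iff)
  have inv: "Jdet g (f x0) * Jdet f x0 = 1" by (rule Jdet_left_inverse[OF U f g gf x0])
  then have pos: "0 < Jdet f x0" by (metis abs_ge_zero less_eq_real_def mult_zero_right zero_neq_one)
  have J: "Jdet g (f x0) = inverse (Jdet f x0)" using inv pos by (simp add: field_simps)
  have Tnear: "\<forall>\<^sub>F n in sequentially. ?T n \<subseteq> W" if "open W" "x0 \<in> W" for W
  proof -
    have "open (f ` U \<inter> g -` W)"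
      using continuous_open_preimage[OF C1_on_imp_continuous_on[OF g] fU that(1)] .
    moreover have "f x0 \<in> f ` U \<inter> g -` W" using x0 that gf by auto
    ultimately have "\<forall>\<^sub>F n in sequentially. S n \<subseteq> f ` U \<inter> g -` W" by (rule near)
    then show ?thesis by eventually_elim (use gf in auto)
  qed
  have Smeas: "\<forall>\<^sub>F n in sequentially. S n \<in> lmeasurable \<and> 0 < ?m (S n)"
    using S by (simp add: shrinks_to_def)
  have upper: "\<forall>\<^sub>F n in sequentially. ?T n \<in> lmeasurable \<and> ?m (?T n) / ?m (S n) \<le> B"
    if B: "inverse (Jdet f x0) < B" for B
  proof -
    have "open (f ` U \<inter> Jdet g -` {..<B})"
      using continuous_open_preimage[OF continuous_on_Jdet[OF g] fU] by auto
    moreover have "f x0 \<in> f ` U \<inter> Jdet g -` {..<B}" using x0 B J by auto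
    ultimately have "\<forall>\<^sub>F n in sequentially. S n \<subseteq> f ` U \<inter> Jdet g -` {..<B}" by (rule near)
    with Smeas show ?thesis
    proof eventually_elim
      case (elim n)
      have img: "y \<in> f ` U" and bd: "Jdet g y \<le> B" if "y \<in> S n" for y
        using subsetD[OF elim(2) that] by auto
      have der: "(g has_derivative frechet_derivative g (at y)) (at y within S n)" if "y \<in> S n" for y
        by (rule has_derivative_at_withinI[OF C1_onD[OF g img[OF that]]])
      have T: "?T n = g ` S n" using img by (intro T_eq subsetI)
      note lm = elim(1)[THEN conjunct1]
      have "?m (g ` S n) / ?m (S n) \<le> B"
        using measure_image_bounded_det[OF lm der bd] elim(1) by (simp add: pos_divide_le_eq)
      with lmeasurable_image_bounded_det[OF lm der bd] show ?case unfolding T by blast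
    qed
  qed
  have lower: "\<forall>\<^sub>F n in sequentially. b \<le> ?m (?T n) / ?m (S n)"
    if b: "0 < b" "b < inverse (Jdet f x0)" for b
  proof -
    have "open (U \<inter> Jdet f -` {..<inverse b})"
      using continuous_open_preimage[OF continuous_on_Jdet[OF f] U] by auto
    moreover have "Jdet f x0 < inverse b" using b pos less_imp_inverse_less by fastforce
    then have "x0 \<in> U \<inter> Jdet f -` {..<inverse b}" using x0 by auto
    ultimately have "\<forall>\<^sub>F n in sequentially. ?T n \<subseteq> U \<inter> Jdet f -` {..<inverse b}" by (rule Tnear)
    moreover have "\<forall>\<^sub>F n in sequentially. ?T n \<in> lmeasurable"
      using upper[of "inverse (Jdet f x0) + 1"] by (auto elim: eventually_mono)
    moreover have "\<forall>\<^sub>F n in sequentially. S n \<subseteq> f ` U" using fU x0 by (intro near) auto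
    ultimately show ?thesis using Smeas
    proof eventually_elim
      case (elim n)
      have TU: "x \<in> U" and bd: "Jdet f x \<le> inverse b" if "x \<in> ?T n" for x
        using subsetD[OF elim(1) that] by auto
      have der: "(f has_derivative frechet_derivative f (at x)) (at x within ?T n)" if "x \<in> ?T n" for x
        by (rule has_derivative_at_withinI[OF C1_onD[OF f TU[OF that]]])
      have fT: "f ` ?T n = S n" using elim(3) by blast
      have "?m (S n) \<le> inverse b * ?m (?T n)"
        using measure_image_bounded_det[OF elim(2) der bd] unfolding fT .
      then show ?case using b elim(4) by (simp add: pos_le_divide_eq field_simps)
    qed
  qed
  show ratio: ?ratio
  proof (rule order_tendstoI)
    fix a assume a: "a < inverse (Jdet f x0)"
    have "max a 0 < inverse (Jdet f x0)" using a pos by simp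
    then obtain b where b: "max a 0 < b" "b < inverse (Jdet f x0)" using dense by blast
    then have "0 < b" "a < b" by auto
    then show "\<forall>\<^sub>F n in sequentially. a < ?m (?T n) / ?m (S n)"
      using lower[of b] b(2) by (auto elim!: eventually_mono)
  next
    fix a assume "inverse (Jdet f x0) < a"
    then obtain b where "inverse (Jdet f x0) < b" "b < a" using dense by blast
    then show "\<forall>\<^sub>F n in sequentially. ?m (?T n) / ?m (S n) < a"
      using upper[of b] by (auto elim!: eventually_mono)
  qed
  have "\<forall>\<^sub>F n in sequentially. 0 < ?m (?T n) / ?m (S n)"
    using order_tendstoD(1)[OF ratio] pos by simp
  then have "\<forall>\<^sub>F n in sequentially. ?T n \<in> lmeasurable \<and> 0 < ?m (?T n)"
    using Smeas upper[of "inverse (Jdet f x0) + 1", simplified]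
    by eventually_elim (auto simp: zero_less_divide_iff)
  then show "shrinks_to ?T x0" using Tnear by (simp add: shrinks_to_def)
qed

lemma Jac_Suc:
  "Jac X f (Suc k) x = Jac X f k (inv_into X f x) * inverse (Jdet f (inv_into X f x))"
proof -
  have "Jac X f (Suc k) x = inverse (Jdet f (inv_into X f x)) * (\<Prod>l=Suc 1..Suc k. inverse (Jdet f ((inv_into X f ^^ l) x)))"
    unfolding Jac_def by (subst prod.atLeast_Suc_atMost) auto
  also have "(\<Prod>l=Suc 1..Suc k. inverse (Jdet f ((inv_into X f ^^ l) x))) = Jac X f k (inv_into X f x)"
    unfolding Jac_def by (subst prod.atLeast_Suc_atMost_Suc_shift) (simp add: funpow_swap1 o_def)
  finally show ?thesis by simp
qed

text \<open>By induction along the backward orbit: with \<open>w\<close> the preimage of \<open>z\<close>, the sets \<open>f -` S n\<close> shrink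
  to \<open>w\<close>, and the ratio telescopes into the ratio for \<open>k\<close> steps at \<open>w\<close> and the ratio for a single
  step at \<open>z\<close>. Injectivity of \<open>f\<close> on all of \<open>X\<close> keeps the singular set from contributing to the preimage
  of a set near \<open>z\<close>.\<close>

lemma iterated_preimage_ratio_tendsto_Jac:
  fixes f :: "real^'n \<Rightarrow> real^'n"
  assumes diff: "C1_diffeo_on f (X - \<Delta>)" and inj: "inj_on f X" and fX: "f \<in> X \<rightarrow> X"
    and "z \<in> Lam X f \<Delta> k" and "z \<in> interior X" and "shrinks_to S z"
  shows "(\<lambda>n. measure lebesgue {x \<in> X. (f ^^ k) x \<in> S n} / measure lebesgue (S n)) \<longlonglongrightarrow> Jac X f k z"
  using assms(4-)
proof (induction k arbitrary: z S)
  case 0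
  then have "\<forall>\<^sub>F n in sequentially. S n \<subseteq> interior X" "\<forall>\<^sub>F n in sequentially. 0 < measure lebesgue (S n)"
    using shrinks_toD(2,3)[OF "0.prems"(3)] by auto
  then have "\<forall>\<^sub>F n in sequentially. measure lebesgue {x \<in> X. (f ^^ 0) x \<in> S n} / measure lebesgue (S n) = Jac X f 0 z"
  proof eventually_elim
    case (elim n)
    then have "{x \<in> X. x \<in> S n} = S n" using interior_subset by blast
    then show ?case using elim by (simp add: Jac_def)
  qed
  then show ?case by (rule tendsto_eventually)
next
  case (Suc k)
  let ?U = "X - \<Delta>" and ?m = "measure lebesgue"
  let ?T = "\<lambda>n. {x \<in> ?U. f x \<in> S n}"
  obtain w where w: "w \<in> Lam X f \<Delta> k" "w \<in> ?U" "z = f w"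
    using Suc.prems(1) Lam_antimono[OF fX, of 0 k] by auto
  have U: "open ?U" "open (f ` ?U)" using diff by (auto simp: C1_diffeo_on_def)
  have wint: "w \<in> interior X" using U(1) w(2) by (meson Diff_subset interior_maximal subsetD)
  have inv: "inv_into X f z = w" using w inj by simp
  note step = shrinks_to_preimage[OF diff w(2) Suc.prems(3)[unfolded w(3)]]
  have "(\<lambda>n. ?m {x \<in> X. (f ^^ k) x \<in> ?T n} / ?m (?T n) * (?m (?T n) / ?m (S n))) \<longlonglongrightarrow> Jac X f (Suc k) z"
    unfolding Jac_Suc inv by (intro tendsto_mult Suc.IH[OF w(1) wint step(2)] step(1))
  moreover have "\<forall>\<^sub>F n in sequentially. S n \<subseteq> f ` ?U" "\<forall>\<^sub>F n in sequentially. 0 < ?m (?T n)"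
    using shrinks_toD(3)[OF Suc.prems(3) U(2)] shrinks_toD(2)[OF step(2)] w by auto
  then have "\<forall>\<^sub>F n in sequentially. ?m {x \<in> X. (f ^^ k) x \<in> ?T n} / ?m (?T n) * (?m (?T n) / ?m (S n))
     = ?m {x \<in> X. (f ^^ Suc k) x \<in> S n} / ?m (S n)"
  proof eventually_elim
    case (elim n)
    have fk: "(f ^^ k) x \<in> X" if "x \<in> X" for x using that fX by (induction k) auto
    have "{x \<in> X. (f ^^ k) x \<in> ?T n} = {x \<in> X. (f ^^ Suc k) x \<in> S n}"
    proof (intro Collect_cong conj_cong refl)
      fix x assume x: "x \<in> X"
      \<comment> \<open>\<open>S n\<close> consists of values of \<open>f\<close> at regular points, and each value is taken only once.\<close>
      have "f y \<in> S n \<Longrightarrow> y \<in> X \<Longrightarrow> y \<in> ?U" for y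
        using elim(1) inj by (auto dest: inj_onD)
      then show "(f ^^ k) x \<in> ?T n \<longleftrightarrow> (f ^^ Suc k) x \<in> S n" using fk[OF x] by auto
    qed
    then show ?case using elim by simp
  qed
  ultimately show ?case by (rule Lim_transform_eventually)
qed

lemma shrinks_to_mball:
  assumes M: "Metric_space X d" and top: "Metric_space.mtopology X d = top_of_set X"
    and X: "X \<in> lmeasurable" and z: "z \<in> interior X"
    and r: "r \<longlonglongrightarrow> 0" "\<And>n. 0 < r n"
  shows "shrinks_to (\<lambda>n. Metric_space.mball X d z (r n)) z"
proof -
  interpret Metric_space X d by fact
  have "mball z (r n) \<in> lmeasurable" for n
    using mball_in_sets[OF M top] X by (intro fmeasurableI2[OF X mball_subset_mspace]) auto
  moreover have "\<forall>\<^sub>F n in sequentially. mball z (r n) \<subseteq> W" if W: "open W" "z \<in> W" for W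
  proof -
    have "openin mtopology (X \<inter> W)" unfolding top using W(1) by (rule openin_open_Int)
    then obtain \<rho> where \<rho>: "0 < \<rho>" "mball z \<rho> \<subseteq> X \<inter> W"
      using W(2) z interior_subset unfolding openin_mtopology by (metis IntI subsetD)
    have "\<forall>\<^sub>F n in sequentially. r n < \<rho>" using order_tendstoD(2)[OF r(1) \<rho>(1)] .
    then show ?thesis by eventually_elim (use \<rho>(2) mball_subset_concentric in fastforce)
  qed
  ultimately show ?thesis
    using measure_mball_pos[OF M top X z] r(2) by (auto simp: shrinks_to_def)
qed

section \<open>The stationary measure and the process\<close>

lemma sets_normalized_lebesgue: "sets (normalized_lebesgue X) = sets (lebesgue_on X)"
  and space_normalized_lebesgue: "space (normalized_lebesgue X) = X"
  by (auto simp: normalized_lebesgue_def space_restrict_space)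

lemma prob_space_normalized_lebesgue:
  assumes "X \<in> lmeasurable" "measure lebesgue X \<noteq> 0"
  shows "prob_space (normalized_lebesgue X)"
proof -
  have "emeasure (lebesgue_on X) X = emeasure lebesgue X"
    using assms by (intro emeasure_restrict_space) auto
  then show ?thesis
    unfolding normalized_lebesgue_def
    using assms by (intro prob_space_uniform_measure) (auto simp: emeasure_eq_measure2)
qed

lemma measure_normalized_lebesgue:
  assumes X: "X \<in> lmeasurable" "measure lebesgue X \<noteq> 0" and A: "A \<in> sets (normalized_lebesgue X)"
  shows "measure (normalized_lebesgue X) A = measure lebesgue A / measure lebesgue X"
proof -
  have AX: "A \<subseteq> X" using sets.sets_into_space[OF A] by (simp add: space_normalized_lebesgue)
  have em: "emeasure (lebesgue_on X) B = emeasure lebesgue B" if "B \<subseteq> X" for B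
    using that X by (intro emeasure_restrict_space) auto
  have "measure (uniform_measure (lebesgue_on X) X) A
      = measure (lebesgue_on X) (X \<inter> A) / measure (lebesgue_on X) X"
    using A X by (intro measure_uniform_measure) (auto simp: em emeasure_eq_measure2 sets_normalized_lebesgue)
  then show ?thesis
    using AX by (simp add: normalized_lebesgue_def measure_def em Int_absorb1)
qed

lemma prob_space_noise:
  assumes "prob_space (normalized_lebesgue X)" "0 < \<epsilon>" "\<epsilon> < 1"
  shows "prob_space (noise \<epsilon> X)"
proof -
  have "prob_space (point_measure {0, 1::nat} (\<lambda>\<eta>. ennreal (if \<eta> = 0 then \<epsilon> else 1 - \<epsilon>)))"
    using assms by (intro prob_spaceI) (simp add: emeasure_point_measure_finite space_point_measure flip: ennreal_plus)
  with assms(1) interpret pair_prob_space "point_measure {0, 1::nat} (\<lambda>\<eta>. ennreal (if \<eta> = 0 then \<epsilon> else 1 - \<epsilon>))"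
    "normalized_lebesgue X"
    by (simp add: pair_prob_space_def pair_sigma_finite_def prob_space_imp_sigma_finite)
  show ?thesis unfolding noise_def by (rule P.prob_space_axioms)
qed

lemma emeasure_noise_Times:
  assumes "prob_space (normalized_lebesgue X)" "I \<subseteq> {0, 1}" "A \<in> sets (normalized_lebesgue X)"
  shows "emeasure (noise \<epsilon> X) (I \<times> A) = (\<Sum>\<eta>\<in>I. ennreal (if \<eta> = 0 then \<epsilon> else 1 - \<epsilon>)) * emeasure (normalized_lebesgue X) A"
proof -
  interpret prob_space "normalized_lebesgue X" by fact
  show ?thesis
    unfolding noise_def using assms
    by (subst emeasure_pair_measure_Times) (auto simp: sets_point_measure emeasure_point_measure_finite)
qed

text \<open>With probability \<open>\<epsilon>\<close> the point is resampled uniformly, otherwise it moves by \<open>f\<close>.\<close>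

lemma perturbed_map_hit_probability:
  assumes P: "prob_space (normalized_lebesgue X)" and A: "A \<in> sets (normalized_lebesgue X)"
  shows "(\<integral>\<^sup>+\<omega>. indicator A (perturbed_map f \<omega> x) \<partial>noise \<epsilon> X)
    = ennreal \<epsilon> * emeasure (normalized_lebesgue X) A + ennreal (1 - \<epsilon>) * indicator A (f x)"
proof -
  let ?m = "normalized_lebesgue X"
  interpret m: prob_space ?m by fact
  have AX: "A \<subseteq> X" using sets.sets_into_space[OF A] by (simp add: space_normalized_lebesgue)
  have X: "X \<in> sets ?m" using sets.top[of ?m] by (simp add: space_normalized_lebesgue)
  have X1: "emeasure ?m X = 1" using m.emeasure_space_1 by (simp add: space_normalized_lebesgue)
  have sp: "space (noise \<epsilon> X) = {0, 1} \<times> X"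
    by (simp add: noise_def space_pair_measure space_point_measure space_normalized_lebesgue)
  \<comment> \<open>\<open>H\<close> collects the noise values that resample into \<open>A\<close>; those that let \<open>f\<close> act form \<open>K\<close>, which
    depends on \<open>x\<close> alone.\<close>
  define H where "H = {0::nat} \<times> A"
  define K where "K = (if f x \<in> A then {1::nat} \<times> X else {})"
  have sets: "H \<in> sets (noise \<epsilon> X)" "K \<in> sets (noise \<epsilon> X)"
    using A X unfolding H_def K_def noise_def by (auto simp: sets_point_measure intro!: pair_measureI)
  have "(\<integral>\<^sup>+\<omega>. indicator A (perturbed_map f \<omega> x) \<partial>noise \<epsilon> X) = (\<integral>\<^sup>+\<omega>. indicator (H \<union> K) \<omega> \<partial>noise \<epsilon> X)"
    by (rule nn_integral_cong) (use AX in \<open>auto simp: sp perturbed_map_def H_def K_def indicator_def\<close>)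
  also have "\<dots> = emeasure (noise \<epsilon> X) (H \<union> K)" using sets by simp
  also have "\<dots> = emeasure (noise \<epsilon> X) H + emeasure (noise \<epsilon> X) K"
    using sets by (intro plus_emeasure[symmetric]) (auto simp: H_def K_def)
  also have "emeasure (noise \<epsilon> X) H = ennreal \<epsilon> * emeasure ?m A"
    unfolding H_def by (subst emeasure_noise_Times[OF P _ A]) auto
  also have "emeasure (noise \<epsilon> X) K = ennreal (1 - \<epsilon>) * indicator A (f x)"
    unfolding K_def using emeasure_noise_Times[OF P _ X, of "{1}" \<epsilon>] by (auto simp: X1)
  finally show ?thesis .
qed

lemma stationary_measure_eq:
  assumes P: "prob_space (normalized_lebesgue X)" and eps: "0 < \<epsilon>" "\<epsilon> < 1"
    and \<mu>: "acsp_measure \<epsilon> X f \<mu>" and f: "f \<in> measurable (normalized_lebesgue X) (normalized_lebesgue X)"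
    and A: "A \<in> sets (normalized_lebesgue X)"
  shows "measure \<mu> A = \<epsilon> * measure (normalized_lebesgue X) A + (1 - \<epsilon>) * measure \<mu> {x \<in> X. f x \<in> A}"
proof -
  let ?m = "normalized_lebesgue X"
  interpret m: prob_space ?m by fact
  have sets: "sets \<mu> = sets ?m" and st: "stationary \<epsilon> X f \<mu>" and "prob_space \<mu>"
    using \<mu> by (auto simp: acsp_measure_def)
  interpret \<mu>: prob_space \<mu> by fact
  have sp: "space \<mu> = X" using sets_eq_imp_space_eq[OF sets] by (simp add: space_normalized_lebesgue)
  have pre: "{x \<in> X. f x \<in> A} \<in> sets \<mu>"
    using measurable_sets[OF f A] unfolding sets by (simp add: space_normalized_lebesgue vimage_def Int_def conj_commute)
  have "emeasure \<mu> A = (\<integral>\<^sup>+x. ennreal \<epsilon> * emeasure ?m A + ennreal (1 - \<epsilon>) * indicator A (f x) \<partial>\<mu>)"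
    using st A by (simp add: stationary_def sets perturbed_map_hit_probability[OF P A])
  also have "\<dots> = (\<integral>\<^sup>+x. ennreal \<epsilon> * emeasure ?m A + ennreal (1 - \<epsilon>) * indicator {x \<in> X. f x \<in> A} x \<partial>\<mu>)"
    by (rule nn_integral_cong) (auto simp: sp indicator_def)
  also have "\<dots> = ennreal \<epsilon> * emeasure ?m A + ennreal (1 - \<epsilon>) * emeasure \<mu> {x \<in> X. f x \<in> A}"
    using pre by (simp add: nn_integral_add nn_integral_cmult_indicator \<mu>.emeasure_space_1)
  finally show ?thesis
    using eps by (simp add: \<mu>.emeasure_eq_measure m.emeasure_eq_measure flip: ennreal_mult ennreal_plus)
qed

text \<open>Unfolding stationarity \<open>q\<close> times amounts to conditioning on the age of the last resampling:
  with probability \<open>\<epsilon> * (1 - \<epsilon>) ^ k\<close> it happened \<open>k\<close> steps ago, and the remaining term belongs to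
  orbits that were not resampled within the last \<open>q\<close> steps.\<close>

lemma stationary_measure_expansion:
  assumes P: "prob_space (normalized_lebesgue X)" and eps: "0 < \<epsilon>" "\<epsilon> < 1"
    and \<mu>: "acsp_measure \<epsilon> X f \<mu>" and f: "f \<in> measurable (normalized_lebesgue X) (normalized_lebesgue X)"
    and A: "A \<in> sets (normalized_lebesgue X)"
  shows "measure \<mu> A = \<epsilon> * (\<Sum>k<q. (1 - \<epsilon>) ^ k * measure (normalized_lebesgue X) {x \<in> X. (f ^^ k) x \<in> A})
     + (1 - \<epsilon>) ^ q * measure \<mu> {x \<in> X. (f ^^ q) x \<in> A}"
proof (induction q)
  case 0
  have "{x \<in> X. x \<in> A} = A" using sets.sets_into_space[OF A] by (auto simp: space_normalized_lebesgue)
  then show ?case by simp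
next
  case (Suc q)
  let ?m = "normalized_lebesgue X"
  have fX: "f x \<in> X" if "x \<in> X" for x using measurable_space[OF f, of x] that by (simp add: space_normalized_lebesgue)
  have "(f ^^ q) \<in> measurable ?m ?m" using f by (rule measurable_compose_n)
  then have B: "{x \<in> X. (f ^^ q) x \<in> A} \<in> sets ?m"
    using measurable_sets[of "f ^^ q" ?m ?m A] A by (simp add: space_normalized_lebesgue vimage_def Int_def conj_commute)
  have "{x \<in> X. f x \<in> {x \<in> X. (f ^^ q) x \<in> A}} = {x \<in> X. (f ^^ Suc q) x \<in> A}"
    using fX by (auto simp: funpow_swap1)
  with stationary_measure_eq[OF P eps \<mu> f B]
  have "measure \<mu> {x \<in> X. (f ^^ q) x \<in> A} = \<epsilon> * measure ?m {x \<in> X. (f ^^ q) x \<in> A}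
     + (1 - \<epsilon>) * measure \<mu> {x \<in> X. (f ^^ Suc q) x \<in> A}" by simp
  with Suc show ?case by (simp add: algebra_simps)
qed

text \<open>The only points whose image after \<open>k\<close> steps can lie outside \<open>\<Lambda>\<^sub>k\<close> are those whose orbit hits the
  singular set before time \<open>k\<close>, and the preimages of a null set under a non-singular map are null.\<close>

lemma AE_funpow_in_Lam:
  assumes f: "nonsingular_map m f" and \<Delta>: "\<Delta> \<in> null_sets m" and sp: "space m = X"
  shows "AE x in m. (f ^^ k) x \<in> Lam X f \<Delta> k"
proof (induction k)
  case 0
  show ?case using AE_space[of m] by (simp add: sp)
next
  case (Suc k)
  have "(f ^^ j) -` \<Delta> \<inter> space m \<in> null_sets m" for j
  proof (induction j)
    case 0 then show ?case using \<Delta> sets.sets_into_space[of \<Delta> m] by (simp add: Int_absorb2 null_setsD2)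
  next
    case (Suc j)
    have "f \<in> measurable m m" using f by (simp add: nonsingular_map_def)
    then have "f x \<in> space m" if "x \<in> space m" for x using that by (rule measurable_space)
    then have "(f ^^ Suc j) -` \<Delta> \<inter> space m = f -` ((f ^^ j) -` \<Delta> \<inter> space m) \<inter> space m"
      by (auto simp: funpow_swap1)
    moreover have "f -` ((f ^^ j) -` \<Delta> \<inter> space m) \<inter> space m \<in> null_sets m"
      using f Suc unfolding nonsingular_map_def by blast
    ultimately show ?case by (simp only:)
  qed
  from AE_not_in[OF this[of k]] Suc show ?case
    using AE_space[of m] by eventually_elim auto
qed

text \<open>This cuts the expansion of the stationary measure down to finitely many terms: a set that
  misses \<open>\<Lambda>\<^sub>q\<close> has a null \<open>q\<close>-fold preimage, also for \<open>\<mu>\<close> by absolute continuity.\<close>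

lemma measure_funpow_preimage_outside_Lam:
  assumes f: "nonsingular_map (normalized_lebesgue X) f" and \<Delta>: "\<Delta> \<in> null_sets (normalized_lebesgue X)"
    and \<mu>: "acsp_measure \<epsilon> X f \<mu>" and A: "A \<inter> Lam X f \<Delta> q = {}"
  shows "measure \<mu> {x \<in> X. (f ^^ q) x \<in> A} = 0"
proof -
  let ?m = "normalized_lebesgue X"
  have sets: "sets \<mu> = sets ?m" and ac: "absolutely_continuous ?m \<mu>"
    using \<mu> by (auto simp: acsp_measure_def)
  have "AE x in \<mu>. (f ^^ q) x \<in> Lam X f \<Delta> q"
    using absolutely_continuous_AE[OF sets ac AE_funpow_in_Lam[OF f \<Delta> space_normalized_lebesgue]] .
  then have "AE x in \<mu>. x \<notin> {x \<in> X. (f ^^ q) x \<in> A}"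
    by eventually_elim (use A in auto)
  then have "emeasure \<mu> {x \<in> X. (f ^^ q) x \<in> A} = 0"
    by (cases "{x \<in> X. (f ^^ q) x \<in> A} \<in> sets \<mu>")
      (simp_all only: emeasure_notin_sets AE_iff_null_sets[symmetric] null_setsD1 not_False_eq_True)
  then show ?thesis by (simp add: measure_def)
qed

lemma measure_process_first_coordinate:
  assumes P: "prob_space (normalized_lebesgue X)" and eps: "0 < \<epsilon>" "\<epsilon> < 1"
    and B: "{x \<in> space \<mu>. Q x} \<in> sets \<mu>"
  shows "measure (process_measure \<epsilon> X \<mu>) {\<zeta> \<in> space (process_measure \<epsilon> X \<mu>). Q (fst \<zeta>)} = measure \<mu> {x \<in> space \<mu>. Q x}"
proof -
  let ?N = "\<Pi>\<^sub>M i\<in>(UNIV::nat set). noise \<epsilon> X"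
  interpret N: prob_space ?N using prob_space_noise[OF P eps] by (intro prob_space_PiM)
  have "{\<zeta> \<in> space (process_measure \<epsilon> X \<mu>). Q (fst \<zeta>)} = {x \<in> space \<mu>. Q x} \<times> space ?N"
    by (auto simp: process_measure_def space_pair_measure)
  then show ?thesis
    unfolding process_measure_def measure_def
    using B by (simp add: N.emeasure_pair_measure_Times N.emeasure_space_1)
qed

text \<open>\<open>\<Lambda>\<^sub>1\<close> is open as the image of the regular set under a diffeomorphism, and the \<open>\<Lambda>\<^sub>k\<close> decrease.\<close>

lemma Lam_subset_interior:
  assumes diff: "C1_diffeo_on f (X - \<Delta>)" and fX: "f \<in> X \<rightarrow> X" and p: "1 \<le> p"
  shows "Lam X f \<Delta> p \<subseteq> interior X"
proof -
  have "Lam X f \<Delta> p \<subseteq> Lam X f \<Delta> (Suc 0)" using p by (intro Lam_antimono[OF fX]) simp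
  also have "\<dots> \<subseteq> interior X"
    using diff fX by (intro interior_maximal) (auto simp: C1_diffeo_on_def)
  finally show ?thesis .
qed

text \<open>The density of \<open>\<mu>\<close> at \<open>z\<close>, as a limit of ratios along shrinking sets. Sets close to \<open>z\<close> miss
  \<open>\<Lambda>\<^bsub>p+1\<^esub>\<close>, because \<open>z\<close> is not in its closure; hence the expansion of \<open>\<mu>\<close> stops after \<open>p + 1\<close> terms,
  and the \<open>k\<close>-th of them contributes its volume distortion \<open>J\<^sub>k(z)\<close>.\<close>

lemma stationary_measure_density:
  fixes f :: "real^'n \<Rightarrow> real^'n"
  assumes X: "X \<in> lmeasurable" "measure lebesgue X \<noteq> 0"
    and \<Delta>: "\<Delta> \<in> null_sets (normalized_lebesgue X)"
    and fX: "f \<in> X \<rightarrow> X" and inj: "inj_on f X" and ns: "nonsingular_map (normalized_lebesgue X) f"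
    and diff: "C1_diffeo_on f (X - \<Delta>)"
    and eps: "0 < \<epsilon>" "\<epsilon> < 1" and \<mu>: "acsp_measure \<epsilon> X f \<mu>"
    and z: "z \<in> Lam X f \<Delta> p - closure (Lam X f \<Delta> (Suc p))" "z \<in> interior X"
    and A: "shrinks_to A z" "\<And>n. A n \<in> sets (normalized_lebesgue X)"
  shows "(\<lambda>n. measure \<mu> (A n) / measure (normalized_lebesgue X) (A n))
     \<longlonglongrightarrow> \<epsilon> * (\<Sum>k=0..p. (1 - \<epsilon>) ^ k * Jac X f k z)"
proof -
  let ?m = "normalized_lebesgue X"
  let ?pre = "\<lambda>k n. {x \<in> X. (f ^^ k) x \<in> A n}"
  note P = prob_space_normalized_lebesgue[OF X]
  have f: "f \<in> measurable ?m ?m" using ns by (simp add: nonsingular_map_def)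
  have pre: "?pre k n \<in> sets ?m" for k n
    using measurable_sets[OF measurable_compose_n[OF f] A(2), of k n]
    by (simp add: space_normalized_lebesgue vimage_def Int_def conj_commute)
  have ratio: "measure ?m (?pre k n) / measure ?m (A n) = measure lebesgue (?pre k n) / measure lebesgue (A n)" for k n
    using X by (simp add: measure_normalized_lebesgue[OF X] pre A(2))
  have lim: "(\<lambda>n. measure ?m (?pre k n) / measure ?m (A n)) \<longlonglongrightarrow> Jac X f k z" if "k \<le> p" for k
    unfolding ratio using z(1) Lam_antimono[OF fX that]
    by (intro iterated_preimage_ratio_tendsto_Jac[OF diff inj fX _ z(2) A(1)]) auto
  have "(\<lambda>n. \<epsilon> * (\<Sum>k=0..p. (1 - \<epsilon>) ^ k * (measure ?m (?pre k n) / measure ?m (A n))))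
     \<longlonglongrightarrow> \<epsilon> * (\<Sum>k=0..p. (1 - \<epsilon>) ^ k * Jac X f k z)"
    by (intro tendsto_mult tendsto_const tendsto_sum lim) simp
  moreover have "\<forall>\<^sub>F n in sequentially. A n \<subseteq> - closure (Lam X f \<Delta> (Suc p))"
    using z(1) by (intro shrinks_toD(3)[OF A(1)]) auto
  then have "\<forall>\<^sub>F n in sequentially. \<epsilon> * (\<Sum>k=0..p. (1 - \<epsilon>) ^ k * (measure ?m (?pre k n) / measure ?m (A n)))
      = measure \<mu> (A n) / measure ?m (A n)"
  proof eventually_elim
    case (elim n)
    have "A n \<inter> Lam X f \<Delta> (Suc p) = {}" using elim closure_subset by blast
    then have zero: "measure \<mu> (?pre (Suc p) n) = 0"
      by (rule measure_funpow_preimage_outside_Lam[OF ns \<Delta> \<mu>])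
    have "measure \<mu> (A n) = \<epsilon> * (\<Sum>k<Suc p. (1 - \<epsilon>) ^ k * measure ?m (?pre k n))"
      using stationary_measure_expansion[OF P eps \<mu> f A(2), of n "Suc p"] unfolding zero by simp
    also have "{..<Suc p} = {0..p}" by auto
    finally show ?case by (simp add: sum_divide_distrib sum_distrib_left)
  qed
  ultimately show ?thesis by (rule Lim_transform_eventually)
qed

theorem proposition4p2:
  fixes X :: "(real^'n) set" and d :: "real^'n \<Rightarrow> real^'n \<Rightarrow> real"
    and N :: nat and Xs :: "nat \<Rightarrow> (real^'n) set" and \<Delta> :: "(real^'n) set"
    and f :: "real^'n \<Rightarrow> real^'n" and m \<mu> :: "(real^'n) measure"
    and \<epsilon> \<tau> y :: real and p :: nat and z :: "real^'n" and a b u :: "nat \<Rightarrow> real"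
  assumes "compact X" and "X = closure (interior X)"
    and "Metric_space X d" and "Metric_space.mtopology X d = top_of_set X"
    and "m = normalized_lebesgue X"
    and "\<And>i. i \<in> {1..N} \<Longrightarrow> open (Xs i) \<and> Xs i \<subseteq> X"
    and "disjoint_family_on Xs {1..N}"
    and "X = (\<Union>i\<in>{1..N}. closure (Xs i))"
    and "\<Delta> = singular_set X N Xs" and "\<Delta> \<in> null_sets m"
    and "f \<in> X \<rightarrow> X" and "inj_on f X" and "nonsingular_map m f"
    and "C1_diffeo_on f (X - \<Delta>)"
    and "0 < \<epsilon>" and "\<epsilon> < 1"
    and "acsp_measure \<epsilon> X f \<mu>"
    and "p \<ge> 1" and "z \<in> Lam X f \<Delta> p - closure (Lam X f \<Delta> (p + 1))"
    and "norm_like_at X d z"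
    and "\<tau> > 0" and "y = - ln \<tau>"
    and "\<And>n. n \<ge> 1 \<Longrightarrow> a n = real CARD('n)"
    and "\<And>n. n \<ge> 1 \<Longrightarrow> u n = y / a n + b n"
    and "\<And>n. n \<ge> 1 \<Longrightarrow>
           measure m (Metric_space.mball X d z (exp (- b n)))
             = inverse (real n * \<epsilon> * (\<Sum>k=0..p. (1 - \<epsilon>) ^ k * Jac X f k z)) \<and>
           inverse (real n * \<epsilon> * (\<Sum>k=0..p. (1 - \<epsilon>) ^ k * Jac X f k z))
             = 1 / (real n * h_density \<epsilon> X f \<Delta> z)"
  shows "(\<lambda>n. real n * measure (process_measure \<epsilon> X \<mu>)
            {\<zeta> \<in> space (process_measure \<epsilon> X \<mu>). neg_log_dist d z (fst \<zeta>) > ereal (u n)})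
          \<longlonglongrightarrow> \<tau>"
proof -
  note M = assms(3) and top = assms(4) and m = assms(5)
    and \<Delta> = assms(10)[unfolded m] and fX = assms(11) and inj = assms(12)
    and ns = assms(13)[unfolded m] and diff = assms(14) and eps = assms(15,16)
    and \<mu> = assms(17) and p = assms(18) and z = assms(19) and nl = assms(20) and \<tau> = assms(21)
  interpret Metric_space X d by fact
  have zi: "z \<in> interior X" using Lam_subset_interior[OF diff fX p] z by auto
  have X: "X \<in> lmeasurable" using assms(1) by (rule lmeasurable_compact)
  have X0: "measure lebesgue X \<noteq> 0"
    using measure_mball_pos[OF M top X zi, of 1] measure_mono_fmeasurable[OF mball_subset_mspace _ X, of z 1]
      mball_in_sets[OF M top, of z 1] X by auto
  note P = prob_space_normalized_lebesgue[OF X X0]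
  have ball_sets: "mball z r \<in> sets m" for r
    using mball_in_sets[OF M top, of z r] X mball_subset_mspace[of z r]
    by (simp add: m sets_normalized_lebesgue sets_restrict_space_iff fmeasurableD)
  have m_eq: "measure m (mball z r) = measure lebesgue (mball z r) / measure lebesgue X" for r
    using measure_normalized_lebesgue[OF X X0 ball_sets[unfolded m]] by (simp add: m)
  have ball_pos: "0 < measure m (mball z r)" if "0 < r" for r
    unfolding m_eq using measure_mball_pos[OF M top X zi that] X0 by (simp add: zero_less_measure_iff)

  define h where "h = \<epsilon> * (\<Sum>k=0..p. (1 - \<epsilon>) ^ k * Jac X f k z)"
  have "0 < (\<Sum>k=0..p. (1 - \<epsilon>) ^ k * Jac X f k z)"
  proof (rule sum_pos2[where i = 0])
    show "0 \<le> (1 - \<epsilon>) ^ k * Jac X f k z" for k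
      using eps by (auto simp: Jac_def intro!: prod_nonneg mult_nonneg_nonneg)
  qed (auto simp: Jac_def)
  then have h: "0 < h" using eps by (simp add: h_def)

  define r where "r n = exp (- b n)" for n
  have r_pos: "0 < r n" for n by (simp add: r_def)
  have ball_r: "measure m (mball z (r n)) = inverse (real n * h)" if "1 \<le> n" for n
    using assms(25)[OF that] by (simp add: r_def h_def mult.assoc)
  \<comment> \<open>The measure of a fixed ball is positive while that of the balls of radius \<open>r n\<close> tends to 0, and
    measures of concentric balls are ordered by their radii.\<close>
  have r0: "r \<longlonglongrightarrow> 0"
  proof (rule order_tendstoI)
    fix a :: real assume "a < 0"
    then show "\<forall>\<^sub>F n in sequentially. a < r n" using r_pos by (auto intro: less_trans always_eventually)
  next
    fix \<rho> :: real assume \<rho>: "0 < \<rho>"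
    have "(\<lambda>n. inverse (real n * h)) \<longlonglongrightarrow> 0"
      using tendsto_mult_left_zero[OF lim_inverse_n, of "inverse h"] by (simp add: inverse_mult_distrib)
    then have "\<forall>\<^sub>F n in sequentially. inverse (real n * h) < measure m (mball z \<rho>)"
      using order_tendstoD(2) ball_pos[OF \<rho>] by blast
    with eventually_ge_at_top[of 1] show "\<forall>\<^sub>F n in sequentially. r n < \<rho>"
    proof eventually_elim
      case (elim n)
      show ?case
      proof (rule ccontr)
        assume "\<not> r n < \<rho>"
        then have "mball z \<rho> \<subseteq> mball z (r n)" by (intro mball_subset_concentric) simp
        moreover interpret prob_space m using P by (simp add: m)
        have "measure m (mball z \<rho>) \<le> measure m (mball z (r n))"
          using calculation ball_sets by (intro finite_measure_mono)
        with elim ball_r[of n] show False by simp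
      qed
    qed
  qed

  \<comment> \<open>Adding \<open>y / D\<close> to the threshold multiplies the radius by this constant, and hence the volume
    by \<open>\<tau>\<close>.\<close>
  define t where "t = \<tau> powr (1 / real CARD('n))"
  have t: "0 < t" "t ^ CARD('n) = \<tau>"
    using \<tau> by (simp_all add: t_def powr_powr flip: powr_realpow)
  have u: "exp (- u n) = t * r n" if "1 \<le> n" for n
    using that \<tau> by (simp add: assms(22-24) t_def r_def powr_def exp_add[symmetric])
  have tr0: "(\<lambda>n. t * r n) \<longlonglongrightarrow> 0" using tendsto_mult_left[OF r0, of t] by simp
  have tr_pos: "0 < t * r n" for n using t(1) r_pos by simp
  let ?A = "\<lambda>n. mball z (t * r n)"
  have "(\<lambda>n. measure \<mu> (?A n) / measure m (?A n)) \<longlonglongrightarrow> h"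
    unfolding h_def m
  proof (rule stationary_measure_density[OF X X0 \<Delta> fX inj ns diff eps \<mu> _ zi])
    show "shrinks_to ?A z" by (rule shrinks_to_mball[OF M top X zi tr0 tr_pos])
  qed (use z ball_sets m in auto)
  moreover have "(\<lambda>n. measure m (?A n) / measure m (mball z (r n))) \<longlonglongrightarrow> \<tau>"
    using measure_mball_scaled_ratio[OF nl M top _ zi t(1) r0 r_pos] X X0
    by (simp add: m_eq t(2) fmeasurableD)
  ultimately have "(\<lambda>n. measure \<mu> (?A n) / measure m (?A n) * (measure m (?A n) / measure m (mball z (r n))) * inverse h)
     \<longlonglongrightarrow> h * \<tau> * inverse h"
    by (intro tendsto_mult tendsto_const)
  also have "h * \<tau> * inverse h = \<tau>" using h by simp
  finally have "(\<lambda>n. measure \<mu> (?A n) / measure m (?A n) * (measure m (?A n) / measure m (mball z (r n))) * inverse h)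
     \<longlonglongrightarrow> \<tau>" .
  moreover have "\<forall>\<^sub>F n in sequentially.
      measure \<mu> (?A n) / measure m (?A n) * (measure m (?A n) / measure m (mball z (r n))) * inverse h
      = real n * measure (process_measure \<epsilon> X \<mu>)
            {\<zeta> \<in> space (process_measure \<epsilon> X \<mu>). neg_log_dist d z (fst \<zeta>) > ereal (u n)}"
    using eventually_ge_at_top[of 1]
  proof eventually_elim
    case (elim n)
    have sets: "sets \<mu> = sets m" using \<mu> by (simp add: acsp_measure_def m)
    then have sp: "space \<mu> = X" using sets_eq_imp_space_eq m space_normalized_lebesgue by metis
    \<comment> \<open>The centre, where the observable is infinite, lies in every ball.\<close>
    have exceed: "neg_log_dist d z x > ereal (u n) \<longleftrightarrow> d z x < exp (- u n)" for x
    proof (cases "d x z = 0")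
      case False
      then have "0 < d x z" using nonneg[of x z] by linarith
      then have "exp (ln (d x z)) = d z x" using commute[of x z] by simp
      then have "d z x < exp (- u n) \<longleftrightarrow> ln (d x z) < - u n" by (metis exp_less_cancel_iff)
      then show ?thesis using False unfolding neg_log_dist_def by (simp only: if_False less_ereal.simps) linarith
    next
      case True
      then have "d z x = 0" using commute[of x z] by simp
      with True show ?thesis by (simp add: neg_log_dist_def)
    qed
    have "z \<in> X" using zi interior_subset by blast
    then have eq: "{x \<in> space \<mu>. neg_log_dist d z x > ereal (u n)} = ?A n"
      unfolding exceed sp mball_def u[OF elim] by simp
    have "measure (process_measure \<epsilon> X \<mu>)
            {\<zeta> \<in> space (process_measure \<epsilon> X \<mu>). neg_log_dist d z (fst \<zeta>) > ereal (u n)} = measure \<mu> (?A n)"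
      using measure_process_first_coordinate[OF P eps, of \<mu> "\<lambda>x. neg_log_dist d z x > ereal (u n)"]
      unfolding eq sets using ball_sets by blast
    moreover have "measure m (?A n) \<noteq> 0" "h \<noteq> 0" using ball_pos[OF tr_pos[of n]] h by auto
    ultimately show ?case
      unfolding ball_r[OF elim] by (simp add: field_simps)
  qed
  ultimately show ?thesis by (rule Lim_transform_eventually)
qed

end
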